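(* Let $\mathbb K$ be a field and let $\Phi=(A,A^*;E_i,E^*_i,i=0..d)$ be a Leonard system over $\mathbb K$. Then there exists a unique $LB$-$UB$ canonical form for $\Phi$. This form is $\Phi^\natural$, where $\natural$ denotes the $LB$-$UB$ canonical map for $\Phi$.
   Context: $\mathrm{Mat}_{d+1}(\mathbb K)$ is the algebra of $(d+1)\times(d+1)$ matrices over $\mathbb K$, rows and columns indexed by $0,1,\dots,d$. A matrix is lower bidiagonal if every nonzero entry lies on the diagonal or the subdiagonal, and upper bidiagonal if its transpose is lower bidiagonal. Leonard systems. Let $\mathcal A$ be a $\mathbb K$-algebra isomorphic to $\mathrm{Mat}_{d+1}(\mathbb K)$. An element $A\in\mathcal A$ is multiplicity-free if it has $d+1$ distinct eigenvalues in $\mathbb K$; if these are $\theta_0,\dots,\theta_d$, the primitive idempotent of $A$ associated with $\theta_i$ is $E_i=\prod_{j\ne i}(A-\theta_jI)/(\theta_i-\theta_j)$. For multiplicity-free $A,A^*\in\mathcal A$ ($A^*$ is just a name, not an adjoint), an idempotent sequence for $A,A^*$ is an ordering $E_0,\dots,E_d$ of the primitive idempotents of $A$ such that $E_iA^*E_j=0$ if $|i-j|>1$ and $E_iA^*E_j\ne0$ if $|i-j|=1$ ($0\le i,j\le d$); a dual idempotent sequence for $A,A^*$ is an idempotent sequence for $A^*,A$. A Leonard system in $\mathcal A$ (with ambient algebra $\mathcal A$, over $\mathbb K$) is a sequence $\Phi=(A,A^*;E_i,E^*_i,i=0..d)$ where $A,A^*\in\mathcal A$ are multiplicity-free, $E_0,\dots,E_d$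 is an idempotent sequence for $A,A^*$ and $E^*_0,\dots,E^*_d$ is a dual idempotent sequence for $A,A^*$. The eigenvalue sequence (resp. dual eigenvalue sequence) of $\Phi$ is $\theta_0,\dots,\theta_d$ (resp. $\theta^*_0,\dots,\theta^*_d$), where $\theta_i$ (resp. $\theta^*_i$) is the eigenvalue of $A$ (resp. $A^*$) associated with $E_i$ (resp. $E^*_i$). Isomorphism. For a $\mathbb K$-algebra isomorphism $\sigma:\mathcal A\to\mathcal A'$, $\Phi^\sigma:=(A^\sigma,A^{*\sigma};E_i^\sigma,E_i^{*\sigma},i=0..d)$ is a Leonard system in $\mathcal A'$. Leonard systems $\Phi,\Phi'$ are isomorphic if $\Phi^\sigma=\Phi'$ for some $\mathbb K$-algebra isomorphism $\sigma$ between their ambient algebras. $LB$-$UB$ canonical form. A Leonard system with eigenvalue sequence $\theta_0,\dots,\theta_d$ and dual eigenvalue sequence $\theta^*_0,\dots,\theta^*_d$ is in $LB$-$UB$ canonical form if (i) its ambient algebra is $\mathrm{Mat}_{d+1}(\mathbb K)$; (ii) $A$ is lower bidiagonal and $A^*$ is upper bidiagonal; (iii) $A_{i,i-1}=1$ for $1\le i\le d$; (iv) $A_{00}=\theta_0$ and $A^*_{00}=\theta^*_0$. An $LB$-$UB$ canonical form for $\Phi$ is a Leonard system over $\mathbb K$ which is isomorphic to $\Phi$ and which is in $LB$-$UB$ canonical form. $LB$-$UB$ canonical map. Let $V$ be an irreducible left $\mathcal A$-module (unique up to isomorphism, of dimension $d+1$). It is known that for a nonzero vector $\eta^*_0\in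 E^*_0V$ the vectors $(A-\theta_{i-1}I)\cdots(A-\theta_1I)(A-\theta_0I)\eta^*_0$ ($0\le i\le d$) form a basis of $V$; such a basis is called a $\Phi$-$LB$-$UB$ basis. With respect to it $A$ is represented by the lower bidiagonal matrix with diagonal entries $\theta_0,\dots,\theta_d$ and subdiagonal entries $1$, and $A^*$ by an upper bidiagonal matrix with diagonal entries $\theta^*_0,\dots,\theta^*_d$ and nonzero superdiagonal entries. For $X\in\mathcal A$ let $X^\natural\in\mathrm{Mat}_{d+1}(\mathbb K)$ be the matrix representing $X$ with respect to a $\Phi$-$LB$-$UB$ basis ($Y$ represents $X$ with respect to $v_0,\dots,v_d$ if $Xv_j=\sum_iY_{ij}v_i$ for all $j$). The resulting $\mathbb K$-algebra isomorphism $\natural:\mathcal A\to\mathrm{Mat}_{d+1}(\mathbb K)$ (independent of choices, since $\dim E^*_0V=1$) is the $LB$-$UB$ canonical map for $\Phi$. *)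

theory Defs
  imports "Jordan_Normal_Form.Char_Poly" "Jordan_Normal_Form.VS_Connect" "HOL-Algebra.QuotRing"
begin

text \<open>The field is a type \<open>'k\<close> of class \<open>field\<close>; as an algebraic structure it is
  \<open>class_ring\<close>. A \<open>'k\<close>-algebra is a \<open>module\<close> record whose ring fields carry the (not necessarily
  commutative) multiplication; the library locale \<open>algebra\<close> covers commutative algebras only.\<close>

locale k_algebra = ring \<A> + module "class_ring :: 'k ring" \<A>
  for \<A> :: "('k :: field, 'a) module" +
  assumes smult_mult_left:
      "\<lbrakk>x \<in> carrier \<A>; y \<in> carrier \<A>\<rbrakk> \<Longrightarrow> (c \<odot>\<^bsub>\<A>\<^esub> x) \<otimes>\<^bsub>\<A>\<^esub> y = c \<odot>\<^bsub>\<A>\<^esub> (x \<otimes>\<^bsub>\<A>\<^esub> y)"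
    and smult_mult_right:
      "\<lbrakk>x \<in> carrier \<A>; y \<in> carrier \<A>\<rbrakk> \<Longrightarrow> x \<otimes>\<^bsub>\<A>\<^esub> (c \<odot>\<^bsub>\<A>\<^esub> y) = c \<odot>\<^bsub>\<A>\<^esub> (x \<otimes>\<^bsub>\<A>\<^esub> y)"

definition alg_iso :: "('k, 'a) module \<Rightarrow> ('k, 'b) module \<Rightarrow> ('a \<Rightarrow> 'b) set" where
  "alg_iso \<A> \<B> =
     {\<sigma> \<in> ring_iso \<A> \<B>. \<forall>c. \<forall>x \<in> carrier \<A>. \<sigma> (c \<odot>\<^bsub>\<A>\<^esub> x) = c \<odot>\<^bsub>\<B>\<^esub> \<sigma> x}"

abbreviation Mat_alg :: "nat \<Rightarrow> ('k :: field, 'k mat) module" where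
  "Mat_alg d \<equiv> module_mat TYPE('k) (d + 1) (d + 1)"

definition lower_bidiagonal :: "'k :: zero mat \<Rightarrow> bool" where
  "lower_bidiagonal M \<longleftrightarrow>
     (\<forall>i < dim_row M. \<forall>j < dim_col M. M $$ (i, j) \<noteq> 0 \<longrightarrow> i = j \<or> i = j + 1)"

definition upper_bidiagonal :: "'k :: zero mat \<Rightarrow> bool" where
  "upper_bidiagonal M \<longleftrightarrow> lower_bidiagonal (transpose_mat M)"


text \<open>Eigenvalues of an element of an algebra isomorphic to a full matrix algebra are those of its
  matrix under an algebra isomorphism; invertibility of \<open>X - tI\<close> does not depend on the
  isomorphism, so neither does this notion.\<close>

definition alg_eigenvalue :: "nat \<Rightarrow> ('k :: field, 'a) module \<Rightarrow> 'a \<Rightarrow> 'k \<Rightarrow> bool" where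
  "alg_eigenvalue d \<A> X t \<longleftrightarrow> (\<exists>\<phi> \<in> alg_iso \<A> (Mat_alg d). eigenvalue (\<phi> X) t)"

definition multiplicity_free :: "nat \<Rightarrow> ('k :: field, 'a) module \<Rightarrow> 'a \<Rightarrow> bool" where
  "multiplicity_free d \<A> X \<longleftrightarrow> X \<in> carrier \<A> \<and> card {t. alg_eigenvalue d \<A> X t} = d + 1"

text \<open>The product over all \<open>j \<noteq> i\<close>, taken in increasing order of \<open>j\<close> because \<open>\<A>\<close> is not
  commutative (the factors commute with each other).\<close>

definition primitive_idempotent :: "('k :: field, 'a) module \<Rightarrow> 'a \<Rightarrow> 'k list \<Rightarrow> nat \<Rightarrow> 'a" where
  "primitive_idempotent \<A> X \<theta> i =
     foldr (\<lambda>j P. (inverse (\<theta> ! i - \<theta> ! j) \<odot>\<^bsub>\<A>\<^esub> (X \<ominus>\<^bsub>\<A>\<^esub> \<theta> ! j \<odot>\<^bsub>\<A>\<^esub> \<one>\<^bsub>\<A>\<^esub>)) \<otimes>\<^bsub>\<A>\<^esub> P)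
       (filter (\<lambda>j. j \<noteq> i) [0..<length \<theta>]) \<one>\<^bsub>\<A>\<^esub>"

text \<open>Sequences indexed by \<open>0, \<dots>, d\<close> are lists of length \<open>d + 1\<close>. The following says that \<open>\<theta>\<close>
  lists the distinct eigenvalues of \<open>X\<close> and that \<open>Es\<close> lists the associated primitive idempotents;
  such a \<open>\<theta>\<close> exists iff \<open>Es\<close> is an ordering of the primitive idempotents of \<open>X\<close>, and it is
  then unique.\<close>

definition eigenvalues_of ::
  "nat \<Rightarrow> ('k :: field, 'a) module \<Rightarrow> 'a \<Rightarrow> 'a list \<Rightarrow> 'k list \<Rightarrow> bool" where
  "eigenvalues_of d \<A> X Es \<theta> \<longleftrightarrow>
     length \<theta> = d + 1 \<and> distinct \<theta> \<and> set \<theta> = {t. alg_eigenvalue d \<A> X t} \<and>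
     Es = map (primitive_idempotent \<A> X \<theta>) [0..<d + 1]"

definition idempotent_sequence ::
  "nat \<Rightarrow> ('k :: field, 'a) module \<Rightarrow> 'a \<Rightarrow> 'a \<Rightarrow> 'a list \<Rightarrow> bool" where
  "idempotent_sequence d \<A> X Y Es \<longleftrightarrow>
     (\<exists>\<theta>. eigenvalues_of d \<A> X Es \<theta>) \<and>
     (\<forall>i \<le> d. \<forall>j \<le> d.
        (\<bar>int i - int j\<bar> > 1 \<longrightarrow> Es ! i \<otimes>\<^bsub>\<A>\<^esub> Y \<otimes>\<^bsub>\<A>\<^esub> Es ! j = \<zero>\<^bsub>\<A>\<^esub>) \<and>
        (\<bar>int i - int j\<bar> = 1 \<longrightarrow> Es ! i \<otimes>\<^bsub>\<A>\<^esub> Y \<otimes>\<^bsub>\<A>\<^esub> Es ! j \<noteq> \<zero>\<^bsub>\<A>\<^esub>))"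

record ('k, 'a) leonard_data =
  ambient :: "('k, 'a) module"
  op_A :: 'a
  op_As :: 'a
  idems_E :: "'a list"
  idems_Es :: "'a list"

definition leonard_system :: "nat \<Rightarrow> ('k :: field, 'a) leonard_data \<Rightarrow> bool" where
  "leonard_system d \<Phi> \<longleftrightarrow>
     k_algebra (ambient \<Phi>) \<and> alg_iso (ambient \<Phi>) (Mat_alg d) \<noteq> {} \<and>
     multiplicity_free d (ambient \<Phi>) (op_A \<Phi>) \<and>
     multiplicity_free d (ambient \<Phi>) (op_As \<Phi>) \<and>
     idempotent_sequence d (ambient \<Phi>) (op_A \<Phi>) (op_As \<Phi>) (idems_E \<Phi>) \<and>
     idempotent_sequence d (ambient \<Phi>) (op_As \<Phi>) (op_A \<Phi>) (idems_Es \<Phi>)"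

definition eigenvalue_sequence :: "nat \<Rightarrow> ('k :: field, 'a) leonard_data \<Rightarrow> 'k list \<Rightarrow> bool" where
  "eigenvalue_sequence d \<Phi> \<theta> \<longleftrightarrow> eigenvalues_of d (ambient \<Phi>) (op_A \<Phi>) (idems_E \<Phi>) \<theta>"

definition dual_eigenvalue_sequence ::
  "nat \<Rightarrow> ('k :: field, 'a) leonard_data \<Rightarrow> 'k list \<Rightarrow> bool" where
  "dual_eigenvalue_sequence d \<Phi> \<theta>s \<longleftrightarrow>
     eigenvalues_of d (ambient \<Phi>) (op_As \<Phi>) (idems_Es \<Phi>) \<theta>s"

definition leonard_image ::
  "('k, 'b) module \<Rightarrow> ('a \<Rightarrow> 'b) \<Rightarrow> ('k, 'a) leonard_data \<Rightarrow> ('k, 'b) leonard_data" where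
  "leonard_image \<B> \<sigma> \<Phi> =
     \<lparr>ambient = \<B>, op_A = \<sigma> (op_A \<Phi>), op_As = \<sigma> (op_As \<Phi>),
      idems_E = map \<sigma> (idems_E \<Phi>), idems_Es = map \<sigma> (idems_Es \<Phi>)\<rparr>"

definition leonard_isomorphic ::
  "('k, 'a) leonard_data \<Rightarrow> ('k, 'b) leonard_data \<Rightarrow> bool" where
  "leonard_isomorphic \<Phi> \<Psi> \<longleftrightarrow>
     (\<exists>\<sigma> \<in> alg_iso (ambient \<Phi>) (ambient \<Psi>). leonard_image (ambient \<Psi>) \<sigma> \<Phi> = \<Psi>)"

definition in_LB_UB_canonical_form :: "nat \<Rightarrow> ('k :: field, 'k mat) leonard_data \<Rightarrow> bool" where
  "in_LB_UB_canonical_form d \<Psi> \<longleftrightarrow>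
     leonard_system d \<Psi> \<and>
     ambient \<Psi> = Mat_alg d \<and>
     lower_bidiagonal (op_A \<Psi>) \<and> upper_bidiagonal (op_As \<Psi>) \<and>
     (\<forall>i. 1 \<le> i \<and> i \<le> d \<longrightarrow> op_A \<Psi> $$ (i, i - 1) = 1) \<and>
     (\<exists>\<theta> \<theta>s. eigenvalue_sequence d \<Psi> \<theta> \<and> dual_eigenvalue_sequence d \<Psi> \<theta>s \<and>
        op_A \<Psi> $$ (0, 0) = \<theta> ! 0 \<and> op_As \<Psi> $$ (0, 0) = \<theta>s ! 0)"

definition LB_UB_canonical_form_for ::
  "nat \<Rightarrow> ('k :: field, 'a) leonard_data \<Rightarrow> ('k, 'k mat) leonard_data \<Rightarrow> bool" where
  "LB_UB_canonical_form_for d \<Phi> \<Psi> \<longleftrightarrow>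
     leonard_isomorphic \<Phi> \<Psi> \<and> in_LB_UB_canonical_form d \<Psi>"


text \<open>Left modules over a noncommutative ring; the library locale \<open>module\<close> needs a commutative
  one. The scalar \<open>c\<close> of the field acts on a left \<open>\<A>\<close>-module as \<open>c \<odot>\<^bsub>\<A>\<^esub> \<one>\<^bsub>\<A>\<^esub>\<close>.\<close>

locale left_module = ring R + M?: abelian_group M
  for R :: "('k, 'a) module" and M :: "('a, 'v) module" +
  assumes act_closed: "\<lbrakk>a \<in> carrier R; v \<in> carrier M\<rbrakk> \<Longrightarrow> a \<odot>\<^bsub>M\<^esub> v \<in> carrier M"
    and act_l_distr: "\<lbrakk>a \<in> carrier R; b \<in> carrier R; v \<in> carrier M\<rbrakk> \<Longrightarrow>
      (a \<oplus>\<^bsub>R\<^esub> b) \<odot>\<^bsub>M\<^esub> v = a \<odot>\<^bsub>M\<^esub> v \<oplus>\<^bsub>M\<^esub> b \<odot>\<^bsub>M\<^esub> v"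
    and act_r_distr: "\<lbrakk>a \<in> carrier R; v \<in> carrier M; w \<in> carrier M\<rbrakk> \<Longrightarrow>
      a \<odot>\<^bsub>M\<^esub> (v \<oplus>\<^bsub>M\<^esub> w) = a \<odot>\<^bsub>M\<^esub> v \<oplus>\<^bsub>M\<^esub> a \<odot>\<^bsub>M\<^esub> w"
    and act_assoc: "\<lbrakk>a \<in> carrier R; b \<in> carrier R; v \<in> carrier M\<rbrakk> \<Longrightarrow>
      (a \<otimes>\<^bsub>R\<^esub> b) \<odot>\<^bsub>M\<^esub> v = a \<odot>\<^bsub>M\<^esub> (b \<odot>\<^bsub>M\<^esub> v)"
    and act_one: "v \<in> carrier M \<Longrightarrow> \<one>\<^bsub>R\<^esub> \<odot>\<^bsub>M\<^esub> v = v"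

definition irreducible_left_module :: "('k, 'a) module \<Rightarrow> ('a, 'v) module \<Rightarrow> bool" where
  "irreducible_left_module \<A> V \<longleftrightarrow>
     left_module \<A> V \<and> carrier V \<noteq> {\<zero>\<^bsub>V\<^esub>} \<and>
     (\<forall>W. Module.submodule W \<A> V \<longrightarrow> W = {\<zero>\<^bsub>V\<^esub>} \<or> W = carrier V)"

primrec LB_UB_vector ::
  "('k, 'a) module \<Rightarrow> ('a, 'v) module \<Rightarrow> 'a \<Rightarrow> 'k list \<Rightarrow> 'v \<Rightarrow> nat \<Rightarrow> 'v" where
  "LB_UB_vector \<A> V X \<theta> \<eta> 0 = \<eta>"
| "LB_UB_vector \<A> V X \<theta> \<eta> (Suc i) =
     (X \<ominus>\<^bsub>\<A>\<^esub> \<theta> ! i \<odot>\<^bsub>\<A>\<^esub> \<one>\<^bsub>\<A>\<^esub>) \<odot>\<^bsub>V\<^esub> LB_UB_vector \<A> V X \<theta> \<eta> i"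

definition LB_UB_basis ::
  "nat \<Rightarrow> ('k :: field, 'a) leonard_data \<Rightarrow> ('a, 'v) module \<Rightarrow> 'v list \<Rightarrow> bool" where
  "LB_UB_basis d \<Phi> V vs \<longleftrightarrow>
     (\<exists>\<theta> \<eta>. eigenvalue_sequence d \<Phi> \<theta> \<and>
        \<eta> \<in> (\<lambda>v. (idems_Es \<Phi> ! 0) \<odot>\<^bsub>V\<^esub> v) ` carrier V \<and> \<eta> \<noteq> \<zero>\<^bsub>V\<^esub> \<and>
        vs = map (LB_UB_vector (ambient \<Phi>) V (op_A \<Phi>) \<theta> \<eta>) [0..<d + 1])"

definition represents ::
  "('k, 'a) module \<Rightarrow> ('a, 'v) module \<Rightarrow> 'v list \<Rightarrow> 'k mat \<Rightarrow> 'a \<Rightarrow> bool" where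
  "represents \<A> V vs Y X \<longleftrightarrow>
     Y \<in> carrier_mat (length vs) (length vs) \<and>
     (\<forall>j < length vs. X \<odot>\<^bsub>V\<^esub> (vs ! j) =
        (\<Oplus>\<^bsub>V\<^esub>i \<in> {..<length vs}. (Y $$ (i, j) \<odot>\<^bsub>\<A>\<^esub> \<one>\<^bsub>\<A>\<^esub>) \<odot>\<^bsub>V\<^esub> (vs ! i)))"

definition LB_UB_canonical_map ::
  "nat \<Rightarrow> ('k :: field, 'a) leonard_data \<Rightarrow> ('a, 'v) module \<Rightarrow> 'a \<Rightarrow> 'k mat" where
  "LB_UB_canonical_map d \<Phi> V X =
     (THE Y. \<exists>vs. LB_UB_basis d \<Phi> V vs \<and> represents (ambient \<Phi>) V vs Y X)"

end

theory Submission
  imports Defs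
begin

text \<open>Let \<open>u\<^sub>i = (A - \<theta>\<^sub>i\<^sub>-\<^sub>1) \<cdots> (A - \<theta>\<^sub>0) \<eta>\<close> with \<open>\<eta>\<close> spanning \<open>E\<^sup>*\<^sub>0 V\<close>. In an eigenbasis of \<open>A\<^sup>*\<close> the
  matrix with columns \<open>u\<^sub>i\<close> is upper triangular, because \<open>A\<close> is irreducible tridiagonal there; in an
  eigenbasis of \<open>A\<close> it is lower triangular. The first fact makes the \<open>u\<^sub>i\<close> a basis with respect to
  which \<open>A\<^sup>*\<close> is upper triangular; the second, together with the tridiagonality of \<open>A\<^sup>*\<close> in an
  eigenbasis of \<open>A\<close>, makes \<open>A\<^sup>*\<close> upper bidiagonal. This gives a canonical form.

  Conversely let \<open>\<rho>\<close> be any isomorphism onto \<open>Mat\<close> that carries \<open>\<Phi>\<close> to a canonical form. The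
  condition \<open>E\<^sub>i\<^sub>-\<^sub>1 A\<^sup>* E\<^sub>i \<noteq> 0\<close> forces the diagonal of \<open>\<rho> A\<close> to be \<open>\<theta>\<^sub>0, \<dots>, \<theta>\<^sub>d\<close> in this order. If
  \<open>e\<^sub>i\<^sub>j\<close> denote the preimages of the matrix units and \<open>\<eta> \<in> E\<^sup>*\<^sub>0 V\<close>, then \<open>e\<^sub>i\<^sub>0 \<eta>\<close> is the \<open>i\<close>-th vector of
  the \<open>LB\<close>-\<open>UB\<close> basis of \<open>\<eta>\<close>, so the matrix of \<open>X\<close> in that basis is \<open>\<rho> X\<close>. Hence \<open>\<rho>\<close> is the canonical
  map, and it is unique: apply this to the left regular module and two choices of \<open>\<rho>\<close>.\<close>

section \<open>Transport along algebra isomorphisms\<close>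

lemma k_algebra_mat: "k_algebra (module_mat TYPE('k::field) n n)"
proof -
  let ?M = "module_mat TYPE('k) n n"
  interpret R: ring "ring_mat TYPE('k) n ()"
    by (rule ring_mat)
  interpret V: vectorspace "class_ring :: 'k ring" ?M
    by (rule matrix_vs)
  have "ring ?M"
    by (rule ringI)
      (auto simp: module_mat_simps V.abelian_group_axioms[unfolded module_mat_def] module_mat_def
        add_mult_distrib_mat mult_add_distrib_mat intro!: monoidI assoc_mult_mat)
  then show ?thesis
    by (intro k_algebra.intro k_algebra_axioms.intro V.module_axioms)
      (auto simp: module_mat_simps)
qed

context k_algebra
begin

lemma is_ring: "ring \<A>"
  by (rule k_algebra.axioms(1)[OF k_algebra_axioms])

lemma scalar_closed [simp, intro]: "x \<in> carrier \<A> \<Longrightarrow> c \<odot>\<^bsub>\<A>\<^esub> x \<in> carrier \<A>"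
  by (rule smult_closed) auto

lemma primitive_idempotent_closed:
  assumes "X \<in> carrier \<A>"
  shows "primitive_idempotent \<A> X \<theta> i \<in> carrier \<A>"
proof -
  have "foldr (\<lambda>j P. (inverse (\<theta> ! i - \<theta> ! j) \<odot>\<^bsub>\<A>\<^esub> (X \<ominus>\<^bsub>\<A>\<^esub> \<theta> ! j \<odot>\<^bsub>\<A>\<^esub> \<one>\<^bsub>\<A>\<^esub>)) \<otimes>\<^bsub>\<A>\<^esub> P)
       js \<one>\<^bsub>\<A>\<^esub> \<in> carrier \<A>" for js
    by (induction js) (use assms in auto)
  then show ?thesis
    by (simp add: primitive_idempotent_def)
qed

end

lemma alg_iso_inv:
  assumes "k_algebra \<A>" and \<sigma>: "\<sigma> \<in> alg_iso \<A> \<B>"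
  shows "inv_into (carrier \<A>) \<sigma> \<in> alg_iso \<B> \<A>"
proof -
  interpret k_algebra \<A> by fact
  let ?g = "inv_into (carrier \<A>) \<sigma>"
  have iso: "\<sigma> \<in> ring_iso \<A> \<B>"
    using \<sigma> by (simp add: alg_iso_def)
  then have bij: "bij_betw \<sigma> (carrier \<A>) (carrier \<B>)"
    by (rule ring_iso_memE)
  have "?g (c \<odot>\<^bsub>\<B>\<^esub> y) = c \<odot>\<^bsub>\<A>\<^esub> ?g y" if "y \<in> carrier \<B>" for c y
  proof -
    from bij that obtain x where x: "x \<in> carrier \<A>" "y = \<sigma> x"
      by (auto simp: bij_betw_def)
    have "c \<odot>\<^bsub>\<B>\<^esub> y = \<sigma> (c \<odot>\<^bsub>\<A>\<^esub> x)"
      using \<sigma> x by (simp add: alg_iso_def)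
    then show ?thesis
      using x bij by (simp add: bij_betw_def inv_into_f_f)
  qed
  then show ?thesis
    using ring_iso_set_sym[OF is_ring iso] by (simp add: alg_iso_def)
qed

lemma alg_iso_comp:
  assumes "\<sigma> \<in> alg_iso \<A> \<B>" "\<tau> \<in> alg_iso \<B> \<C>"
  shows "\<tau> \<circ> \<sigma> \<in> alg_iso \<A> \<C>"
  using assms ring_iso_memE(1) ring_iso_set_trans unfolding alg_iso_def by fastforce

text \<open>Every notion that enters a Leonard system is built from the algebra operations, so an
  isomorphism carries each of them over. The locale collects these transfers.\<close>

locale alg_isomorphism = A: k_algebra \<A> + B: k_algebra \<B>
  for \<A> :: "('k :: field, 'a) module" and \<B> :: "('k, 'b) module" +
  fixes \<sigma> :: "'a \<Rightarrow> 'b"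
  assumes iso: "\<sigma> \<in> alg_iso \<A> \<B>"
begin

lemma ring_iso: "\<sigma> \<in> ring_iso \<A> \<B>"
  using iso by (simp add: alg_iso_def)

lemma ring_hom: "\<sigma> \<in> Ring.ring_hom \<A> \<B>"
  using ring_iso by (simp add: ring_iso_def)

lemmas closed [simp, intro] = ring_iso_memE(1)[OF ring_iso]
lemmas mult [simp] = ring_iso_memE(2)[OF ring_iso]
lemmas add [simp] = ring_iso_memE(3)[OF ring_iso]
lemmas one [simp] = ring_iso_memE(4)[OF ring_iso]
lemmas bij = ring_iso_memE(5)[OF ring_iso]

lemma smult [simp]: "x \<in> carrier \<A> \<Longrightarrow> \<sigma> (c \<odot>\<^bsub>\<A>\<^esub> x) = c \<odot>\<^bsub>\<B>\<^esub> \<sigma> x"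
  using iso by (simp add: alg_iso_def)

lemma eq_iff: "x \<in> carrier \<A> \<Longrightarrow> y \<in> carrier \<A> \<Longrightarrow> \<sigma> x = \<sigma> y \<longleftrightarrow> x = y"
  using bij by (auto simp: bij_betw_def inj_on_def)

lemma zero [simp]: "\<sigma> \<zero>\<^bsub>\<A>\<^esub> = \<zero>\<^bsub>\<B>\<^esub>"
  using ring_hom_zero[OF ring_hom A.is_ring B.is_ring] .

lemma minus [simp]:
  assumes "x \<in> carrier \<A>" "y \<in> carrier \<A>"
  shows "\<sigma> (x \<ominus>\<^bsub>\<A>\<^esub> y) = \<sigma> x \<ominus>\<^bsub>\<B>\<^esub> \<sigma> y"
proof -
  interpret ring_hom_ring \<A> \<B> \<sigma>
    by (intro ring_hom_ringI2 A.is_ring B.is_ring ring_hom)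
  show ?thesis
    using assms by (simp add: a_minus_def)
qed

lemma primitive_idempotent:
  assumes "X \<in> carrier \<A>"
  shows "\<sigma> (primitive_idempotent \<A> X \<theta> i) = primitive_idempotent \<B> (\<sigma> X) \<theta> i"
proof -
  let ?F = "\<lambda>js. foldr (\<lambda>j P. (inverse (\<theta> ! i - \<theta> ! j) \<odot>\<^bsub>\<A>\<^esub> (X \<ominus>\<^bsub>\<A>\<^esub> \<theta> ! j \<odot>\<^bsub>\<A>\<^esub> \<one>\<^bsub>\<A>\<^esub>)) \<otimes>\<^bsub>\<A>\<^esub> P)
       js \<one>\<^bsub>\<A>\<^esub>"
  \<comment> \<open>The index list is generalized for the induction, and membership in the carrier
    is carried along because the homomorphism laws require it.\<close>
  have "?F js \<in> carrier \<A> \<and> \<sigma> (?F js) =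
    foldr (\<lambda>j P. (inverse (\<theta> ! i - \<theta> ! j) \<odot>\<^bsub>\<B>\<^esub> (\<sigma> X \<ominus>\<^bsub>\<B>\<^esub> \<theta> ! j \<odot>\<^bsub>\<B>\<^esub> \<one>\<^bsub>\<B>\<^esub>)) \<otimes>\<^bsub>\<B>\<^esub> P) js \<one>\<^bsub>\<B>\<^esub>" for js
    by (induction js) (use assms in auto)
  then show ?thesis
    by (simp add: primitive_idempotent_def)
qed

lemma inverse_iso: "alg_isomorphism \<B> \<A> (inv_into (carrier \<A>) \<sigma>)"
  by (intro alg_isomorphism.intro alg_isomorphism_axioms.intro A.k_algebra_axioms B.k_algebra_axioms
      alg_iso_inv iso)

text \<open>Composing a witnessing isomorphism onto the matrix algebra with \<open>\<sigma>\<close>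
  or its inverse gives a witness for the other algebra.\<close>

lemma alg_eigenvalue_iff:
  assumes "X \<in> carrier \<A>"
  shows "alg_eigenvalue d \<B> (\<sigma> X) t \<longleftrightarrow> alg_eigenvalue d \<A> X t"
proof
  assume "alg_eigenvalue d \<B> (\<sigma> X) t"
  then obtain \<phi> where "\<phi> \<in> alg_iso \<B> (Mat_alg d)" "eigenvalue (\<phi> (\<sigma> X)) t"
    by (auto simp: alg_eigenvalue_def)
  then show "alg_eigenvalue d \<A> X t"
    unfolding alg_eigenvalue_def
    by (intro bexI[of _ "\<phi> \<circ> \<sigma>"] alg_iso_comp[OF iso]) simp_all
next
  let ?g = "inv_into (carrier \<A>) \<sigma>"
  assume "alg_eigenvalue d \<A> X t"
  then obtain \<phi> where "\<phi> \<in> alg_iso \<A> (Mat_alg d)" "eigenvalue (\<phi> X) t"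
    by (auto simp: alg_eigenvalue_def)
  moreover have "X = ?g (\<sigma> X)"
    using assms bij by (simp add: bij_betw_def)
  ultimately show "alg_eigenvalue d \<B> (\<sigma> X) t"
    unfolding alg_eigenvalue_def
    by (intro bexI[of _ "\<phi> \<circ> ?g"] alg_iso_comp[OF alg_iso_inv[OF A.k_algebra_axioms iso]]) simp_all
qed

lemma eigenvalues_of:
  assumes "X \<in> carrier \<A>" "eigenvalues_of d \<A> X Es \<theta>"
  shows "eigenvalues_of d \<B> (\<sigma> X) (map \<sigma> Es) \<theta>"
  using assms by (simp add: eigenvalues_of_def alg_eigenvalue_iff primitive_idempotent)

lemma multiplicity_free:
  assumes "multiplicity_free d \<A> X"
  shows "multiplicity_free d \<B> (\<sigma> X)"
  using assms by (auto simp add: multiplicity_free_def alg_eigenvalue_iff)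

lemma idempotent_sequence:
  assumes "X \<in> carrier \<A>" "Y \<in> carrier \<A>" "idempotent_sequence d \<A> X Y Es"
  shows "idempotent_sequence d \<B> (\<sigma> X) (\<sigma> Y) (map \<sigma> Es)"
proof -
  from assms(3) obtain \<theta> where \<theta>: "eigenvalues_of d \<A> X Es \<theta>"
    by (auto simp: idempotent_sequence_def)
  then have Es: "Es = map (primitive_idempotent \<A> X \<theta>) [0..<d + 1]"
    by (simp add: eigenvalues_of_def)
  have cl: "Es ! i \<in> carrier \<A>" and nth: "map \<sigma> Es ! i = \<sigma> (Es ! i)" if "i \<le> d" for i
    using that assms(1) unfolding Es
    by (simp_all add: A.primitive_idempotent_closed del: upt_Suc)
  have eq: "map \<sigma> Es ! i \<otimes>\<^bsub>\<B>\<^esub> \<sigma> Y \<otimes>\<^bsub>\<B>\<^esub> map \<sigma> Es ! j = \<zero>\<^bsub>\<B>\<^esub> \<longleftrightarrow>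
    Es ! i \<otimes>\<^bsub>\<A>\<^esub> Y \<otimes>\<^bsub>\<A>\<^esub> Es ! j = \<zero>\<^bsub>\<A>\<^esub>" if "i \<le> d" "j \<le> d" for i j
  proof -
    have "map \<sigma> Es ! i \<otimes>\<^bsub>\<B>\<^esub> \<sigma> Y \<otimes>\<^bsub>\<B>\<^esub> map \<sigma> Es ! j = \<sigma> (Es ! i \<otimes>\<^bsub>\<A>\<^esub> Y \<otimes>\<^bsub>\<A>\<^esub> Es ! j)"
      using that assms(2) cl by (simp add: nth)
    then show ?thesis
      using that assms(2) cl eq_iff[of "Es ! i \<otimes>\<^bsub>\<A>\<^esub> Y \<otimes>\<^bsub>\<A>\<^esub> Es ! j" "\<zero>\<^bsub>\<A>\<^esub>"] by simp
  qed
  have "\<forall>i \<le> d. \<forall>j \<le> d.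
        (\<bar>int i - int j\<bar> > 1 \<longrightarrow> map \<sigma> Es ! i \<otimes>\<^bsub>\<B>\<^esub> \<sigma> Y \<otimes>\<^bsub>\<B>\<^esub> map \<sigma> Es ! j = \<zero>\<^bsub>\<B>\<^esub>) \<and>
        (\<bar>int i - int j\<bar> = 1 \<longrightarrow> map \<sigma> Es ! i \<otimes>\<^bsub>\<B>\<^esub> \<sigma> Y \<otimes>\<^bsub>\<B>\<^esub> map \<sigma> Es ! j \<noteq> \<zero>\<^bsub>\<B>\<^esub>)"
    using assms(3) unfolding idempotent_sequence_def by (metis eq)
  then show ?thesis
    using eigenvalues_of[OF assms(1) \<theta>] unfolding idempotent_sequence_def by blast
qed

end

text \<open>Allows an abstract Leonard system to be replaced by one made of matrices. The new
  ambient algebra is isomorphic to the matrix algebra through the inverse of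
  \<open>\<sigma>\<close>.\<close>

lemma leonard_system_image:
  assumes "leonard_system d \<Phi>" "k_algebra \<B>" "\<sigma> \<in> alg_iso (ambient \<Phi>) \<B>"
  shows "leonard_system d (leonard_image \<B> \<sigma> \<Phi>)"
proof -
  interpret alg_isomorphism "ambient \<Phi>" \<B> \<sigma>
    using assms by (intro alg_isomorphism.intro alg_isomorphism_axioms.intro)
      (auto simp: leonard_system_def)
  obtain \<phi> where "\<phi> \<in> alg_iso (ambient \<Phi>) (Mat_alg d)"
    using assms(1) by (auto simp: leonard_system_def)
  with inverse_iso have "alg_iso \<B> (Mat_alg d) \<noteq> {}"
    using alg_iso_comp alg_isomorphism.iso by blast
  then show ?thesis
    using assms(1,2) idempotent_sequence multiplicity_free
    by (auto simp: leonard_system_def leonard_image_def multiplicity_free_def)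
qed

section \<open>Diagonalization\<close>

text \<open>Phrased inside the algebra, being an eigenvalue is visibly invariant under automorphisms; in
  \<open>alg_eigenvalue\<close> each eigenvalue may be witnessed by a different isomorphism.\<close>

lemma eigenvalue_iff_mat:
  fixes X :: "'k :: field mat"
  assumes X: "X \<in> carrier_mat n n"
  shows "eigenvalue X t \<longleftrightarrow> (\<exists>Y \<in> carrier_mat n n. Y \<noteq> 0\<^sub>m n n \<and> X * Y = t \<cdot>\<^sub>m Y)"
proof
  assume "eigenvalue X t"
  then obtain v where v: "v \<in> carrier_vec n" "v \<noteq> 0\<^sub>v n" "X *\<^sub>v v = t \<cdot>\<^sub>v v"
    using X by (auto simp: eigenvalue_def eigenvector_def)
  \<comment> \<open>All columns of \<open>Y\<close> equal the eigenvector, which turns the vector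
    equation into an equation inside the algebra.\<close>
  define Y where "Y = mat n n (\<lambda>(i, j). v $ i)"
  have col: "col Y j = v" if "j < n" for j
    using v that by (auto simp: Y_def)
  have "X * Y = t \<cdot>\<^sub>m Y"
  proof (rule eq_matI)
    fix i j assume ij: "i < dim_row (t \<cdot>\<^sub>m Y)" "j < dim_col (t \<cdot>\<^sub>m Y)"
    then have "(X * Y) $$ (i, j) = (X *\<^sub>v v) $ i"
      using X col by (auto simp: Y_def)
    then show "(X * Y) $$ (i, j) = (t \<cdot>\<^sub>m Y) $$ (i, j)"
      using v ij by (auto simp: Y_def)
  qed (use X in \<open>auto simp: Y_def\<close>)
  moreover have "Y \<noteq> 0\<^sub>m n n"
  proof
    assume "Y = 0\<^sub>m n n"
    moreover obtain i where "i < n" "v $ i \<noteq> 0"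
      using v by (auto simp: vec_eq_iff)
    ultimately show False
      by (metis Y_def case_prod_conv index_mat(1) index_zero_mat(1))
  qed
  ultimately show "\<exists>Y \<in> carrier_mat n n. Y \<noteq> 0\<^sub>m n n \<and> X * Y = t \<cdot>\<^sub>m Y"
    by (auto simp: Y_def)
next
  assume "\<exists>Y \<in> carrier_mat n n. Y \<noteq> 0\<^sub>m n n \<and> X * Y = t \<cdot>\<^sub>m Y"
  then obtain Y where Y: "Y \<in> carrier_mat n n" "Y \<noteq> 0\<^sub>m n n" "X * Y = t \<cdot>\<^sub>m Y"
    by blast
  \<comment> \<open>A nonzero entry selects a nonzero column of \<open>Y\<close>, and this column is
    an eigenvector.\<close>
  then obtain i j where ij: "i < n" "j < n" "Y $$ (i, j) \<noteq> 0"
    by (metis carrier_matD eq_matI index_zero_mat)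
  have "X *\<^sub>v col Y j = col (t \<cdot>\<^sub>m Y) j"
    using col_mult2[OF X Y(1) ij(2)] unfolding Y(3) by (rule sym)
  also have "\<dots> = t \<cdot>\<^sub>v col Y j"
    using Y(1) ij by (intro eq_vecI) auto
  finally have "X *\<^sub>v col Y j = t \<cdot>\<^sub>v col Y j" .
  moreover have "col Y j \<noteq> 0\<^sub>v n"
    using ij Y(1) by (metis carrier_matD index_col index_zero_vec(1))
  ultimately show "eigenvalue X t"
    using X Y(1) ij unfolding eigenvalue_def eigenvector_def by (intro exI[of _ "col Y j"]) auto
qed

text \<open>The witness is some automorphism \<open>\<phi>\<close> of the matrix algebra. Its
  inverse carries \<open>\<phi> X * Y = t \<cdot>\<^sub>m Y\<close> to the same equation for
  \<open>X\<close>, with a matrix that is still nonzero.\<close>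

lemma alg_eigenvalue_mat:
  fixes X :: "'k :: field mat"
  assumes X: "X \<in> carrier_mat (d + 1) (d + 1)" and "alg_eigenvalue d (Mat_alg d) X t"
  shows "eigenvalue X t"
proof -
  obtain \<phi> :: "'k mat \<Rightarrow> 'k mat"
    where \<phi>: "\<phi> \<in> alg_iso (Mat_alg d) (Mat_alg d)" and ev: "eigenvalue (\<phi> X) t"
    using assms(2) by (auto simp: alg_eigenvalue_def)
  interpret F: alg_isomorphism "Mat_alg d :: ('k, 'k mat) module" "Mat_alg d" \<phi>
    by (intro alg_isomorphism.intro alg_isomorphism_axioms.intro k_algebra_mat \<phi>)
  interpret G: alg_isomorphism "Mat_alg d :: ('k, 'k mat) module" "Mat_alg d"
    "inv_into (carrier (Mat_alg d)) \<phi>"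
    by (rule F.inverse_iso)
  define g where "g = inv_into (carrier (Mat_alg d :: ('k, 'k mat) module)) \<phi>"
  have g: "g (\<phi> X) = X"
    using F.bij X by (simp add: g_def bij_betw_def module_mat_simps)
  have "\<phi> X \<in> carrier_mat (d + 1) (d + 1)"
    using F.closed[of X] X by (simp add: module_mat_simps)
  note \<phi>X = this
  obtain Y where Y: "Y \<in> carrier_mat (d + 1) (d + 1)" "Y \<noteq> 0\<^sub>m (d + 1) (d + 1)"
    "\<phi> X * Y = t \<cdot>\<^sub>m Y"
    using ev unfolding eigenvalue_iff_mat[OF \<phi>X] by blast
  have gY: "g Y \<in> carrier_mat (d + 1) (d + 1)"
    using G.closed[of Y] Y by (simp add: module_mat_simps g_def)
  moreover have "g Y \<noteq> 0\<^sub>m (d + 1) (d + 1)"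
    using G.eq_iff[of Y "\<zero>\<^bsub>Mat_alg d\<^esub>"] G.zero Y by (simp add: module_mat_simps g_def)
  moreover have "X * g Y = t \<cdot>\<^sub>m g Y"
    using G.mult[of "\<phi> X" Y] G.smult[of Y t] Y \<phi>X g by (simp add: module_mat_simps g_def)
  ultimately show ?thesis
    unfolding eigenvalue_iff_mat[OF X] by blast
qed

lemma a_minus_mat:
  fixes X Y :: "'k :: field mat"
  assumes "X \<in> carrier_mat n n" "Y \<in> carrier_mat n n"
  shows "X \<ominus>\<^bsub>module_mat TYPE('k) n n\<^esub> Y = X - Y"
proof -
  interpret k_algebra "module_mat TYPE('k) n n"
    by (rule k_algebra_mat)
  interpret ring "module_mat TYPE('k) n n"
    by (rule is_ring)
  have "\<ominus>\<^bsub>module_mat TYPE('k) n n\<^esub> Y = - Y"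
    by (rule minus_equality) (use assms in \<open>auto simp: module_mat_simps\<close>)
  then show ?thesis
    using assms by (simp add: a_minus_def module_mat_simps minus_add_uminus_mat)
qed

lemma primitive_idempotent_mat_closed:
  "X \<in> carrier_mat n n \<Longrightarrow>
    primitive_idempotent (module_mat TYPE('k :: field) n n) X \<theta> i \<in> carrier_mat n n"
  using k_algebra.primitive_idempotent_closed[OF k_algebra_mat, of X n]
  by (simp add: module_mat_simps)

text \<open>A primitive idempotent is a polynomial in its matrix, and \<open>Q\<close> can be moved
  past the factors one by one. \<open>Q\<close> may be singular: the lemma is applied to a matrix of
  eigenvectors in order to show that it is invertible.\<close>

lemma primitive_idempotent_intertwine:
  fixes X Y Q :: "'k :: field mat"
  assumes X: "X \<in> carrier_mat n n" and Y: "Y \<in> carrier_mat n n" and Q: "Q \<in> carrier_mat n n"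
    and XQ: "X * Q = Q * Y"
  shows "primitive_idempotent (module_mat TYPE('k) n n) X \<theta> i * Q =
    Q * primitive_idempotent (module_mat TYPE('k) n n) Y \<theta> i"
proof -
  let ?M = "module_mat TYPE('k) n n"
  let ?f = "\<lambda>X j. inverse (\<theta> ! i - \<theta> ! j) \<odot>\<^bsub>?M\<^esub> (X \<ominus>\<^bsub>?M\<^esub> \<theta> ! j \<odot>\<^bsub>?M\<^esub> \<one>\<^bsub>?M\<^esub>)"
  let ?F = "\<lambda>X. foldr (\<lambda>j P. ?f X j \<otimes>\<^bsub>?M\<^esub> P)"
  have f: "?f Z j \<in> carrier_mat n n" if "Z \<in> carrier_mat n n" for Z j
    using that by (auto simp: module_mat_simps a_minus_mat)
  have fQ: "?f X j * Q = Q * ?f Y j" for j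
  proof -
    let ?t = "\<theta> ! j"
    have "(X - ?t \<cdot>\<^sub>m 1\<^sub>m n) * Q = X * Q - ?t \<cdot>\<^sub>m Q"
      using X Q by (subst minus_mult_distrib_mat[of _ n n _ _ n])
        (auto simp: mult_smult_assoc_mat[of _ n n _ n])
    also have "\<dots> = Q * (Y - ?t \<cdot>\<^sub>m 1\<^sub>m n)"
      using Y Q XQ by (subst mult_minus_distrib_mat[of _ n n _ n])
        (auto simp: mult_smult_distrib[of _ n n _ n])
    finally have "(X - ?t \<cdot>\<^sub>m 1\<^sub>m n) * Q = Q * (Y - ?t \<cdot>\<^sub>m 1\<^sub>m n)" .
    moreover have "Z - ?t \<cdot>\<^sub>m 1\<^sub>m n \<in> carrier_mat n n" for Z
      by (auto intro!: minus_carrier_mat)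
    ultimately show ?thesis
      using X Y Q by (simp add: module_mat_simps a_minus_mat
        mult_smult_distrib[of _ n n _ n] mult_smult_assoc_mat[of _ n n _ n])
  qed
  have "?F X js \<one>\<^bsub>?M\<^esub> \<in> carrier_mat n n \<and> ?F Y js \<one>\<^bsub>?M\<^esub> \<in> carrier_mat n n \<and>
    ?F X js \<one>\<^bsub>?M\<^esub> * Q = Q * ?F Y js \<one>\<^bsub>?M\<^esub>" for js
  proof (induction js)
    case Nil
    then show ?case using Q by (simp add: module_mat_simps)
  next
    case (Cons j js)
    let ?U = "?F X js \<one>\<^bsub>?M\<^esub>" and ?V = "?F Y js \<one>\<^bsub>?M\<^esub>"
    have c: "?U \<in> carrier_mat n n" "?V \<in> carrier_mat n n" and UQ: "?U * Q = Q * ?V"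
      using Cons by auto
    have "?f X j * ?U * Q = ?f X j * (?U * Q)"
      using assoc_mult_mat[OF f[OF X] c(1) Q] .
    also have "\<dots> = ?f X j * Q * ?V"
      unfolding UQ using assoc_mult_mat[OF f[OF X] Q c(2)] by simp
    also have "\<dots> = Q * (?f Y j * ?V)"
      unfolding fQ using assoc_mult_mat[OF Q f[OF Y] c(2)] .
    finally show ?case
      using mult_carrier_mat[OF f[OF X] c(1), of j] mult_carrier_mat[OF f[OF Y] c(2), of j]
      by (simp add: module_mat_simps(1))
  qed
  then show ?thesis
    by (simp add: primitive_idempotent_def)
qed

abbreviation diag_unit :: "nat \<Rightarrow> nat \<Rightarrow> 'k :: field mat" where
  "diag_unit n i \<equiv> mat_diag n (\<lambda>k. if k = i then 1 else 0)"

text \<open>The diagonal entry at position k is the Lagrange basis polynomial of node i evaluated at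
  node k.\<close>

lemma primitive_idempotent_mat_diag:
  fixes \<theta> :: "'k :: field list"
  assumes len: "length \<theta> = n" and "distinct \<theta>" and i: "i < n"
  shows "primitive_idempotent (module_mat TYPE('k) n n) (mat_diag n ((!) \<theta>)) \<theta> i = diag_unit n i"
proof -
  let ?M = "module_mat TYPE('k) n n"
  let ?f = "\<lambda>j. inverse (\<theta> ! i - \<theta> ! j) \<odot>\<^bsub>?M\<^esub> (mat_diag n ((!) \<theta>) \<ominus>\<^bsub>?M\<^esub> \<theta> ! j \<odot>\<^bsub>?M\<^esub> \<one>\<^bsub>?M\<^esub>)"
  let ?c = "\<lambda>j k. inverse (\<theta> ! i - \<theta> ! j) * (\<theta> ! k - \<theta> ! j)"
  have f: "?f j = mat_diag n (?c j)" for j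
    by (rule eq_matI) (auto simp: module_mat_simps a_minus_mat mat_diag_def)
  have "foldr (\<lambda>j P. ?f j \<otimes>\<^bsub>?M\<^esub> P) js \<one>\<^bsub>?M\<^esub> = mat_diag n (\<lambda>k. prod_list (map (\<lambda>j. ?c j k) js))" for js
  proof (induction js)
    case (Cons j js)
    then show ?case
      by (simp only: foldr_Cons o_apply f module_mat_simps(1) mat_diag_diag list.map prod_list.Cons)
  qed (simp add: module_mat_simps)
  then have *: "primitive_idempotent ?M (mat_diag n ((!) \<theta>)) \<theta> i =
    mat_diag n (\<lambda>k. prod_list (map (\<lambda>j. ?c j k) (filter (\<lambda>j. j \<noteq> i) [0..<length \<theta>])))"
    by (simp add: primitive_idempotent_def)
  have "prod_list (map (\<lambda>j. ?c j k) (filter (\<lambda>j. j \<noteq> i) [0..<length \<theta>])) = (if k = i then 1 else 0)"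
    if "k < n" for k
  proof (cases "k = i")
    case True
    have "?c j i = 1" if "j \<in> set (filter (\<lambda>j. j \<noteq> i) [0..<length \<theta>])" for j
      using that assms by (auto simp: nth_eq_iff_index_eq)
    then have "map (\<lambda>j. ?c j i) (filter (\<lambda>j. j \<noteq> i) [0..<length \<theta>]) =
      map (\<lambda>j. 1) (filter (\<lambda>j. j \<noteq> i) [0..<length \<theta>])"
      by (intro map_cong) auto
    then show ?thesis
      using True by (simp add: prod_list_replicate map_replicate_const)
  next
    case False
    \<comment> \<open>The factor with j = k is zero.\<close>
    then show ?thesis
      using that len by (auto simp: prod_list_zero_iff)
  qed
  then show ?thesis
    unfolding * by (auto simp: mat_diag_def)
qed

lemma obtain_inverse_mat:
  fixes Q :: "'k :: field mat"
  assumes Q: "Q \<in> carrier_mat n n" and "det Q \<noteq> 0"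
  obtains R where "R \<in> carrier_mat n n" "Q * R = 1\<^sub>m n" "R * Q = 1\<^sub>m n"
  using det_non_zero_imp_unit[OF assms, of "()"] by (auto simp: Units_def ring_mat_def)

text \<open>The columns of \<open>Q\<close> are eigenvectors. Their independence comes from the
  idempotents: if \<open>Q\<close> kills a vector \<open>c\<close> with \<open>c $ i\<close>
  nonzero, applying the i-th idempotent isolates \<open>c $ i\<close> times the i-th eigenvector,
  which would have to vanish.\<close>

lemma diagonalize:
  fixes X :: "'k :: field mat"
  assumes X: "X \<in> carrier_mat n n" and len: "length \<theta> = n" and dist: "distinct \<theta>"
    and ev: "\<And>i. i < n \<Longrightarrow> eigenvalue X (\<theta> ! i)"
  obtains Q R where "Q \<in> carrier_mat n n" "R \<in> carrier_mat n n" "Q * R = 1\<^sub>m n" "R * Q = 1\<^sub>m n"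
    "X * Q = Q * mat_diag n ((!) \<theta>)"
    "\<And>i. i < n \<Longrightarrow> primitive_idempotent (module_mat TYPE('k) n n) X \<theta> i * Q = Q * diag_unit n i"
proof -
  let ?D = "mat_diag n ((!) \<theta>)"
  have "\<exists>v. \<forall>i<n. v i \<in> carrier_vec n \<and> v i \<noteq> 0\<^sub>v n \<and> X *\<^sub>v v i = \<theta> ! i \<cdot>\<^sub>v v i"
    using ev X unfolding eigenvalue_def eigenvector_def by (metis carrier_matD(1))
  then obtain v where v: "\<And>i. i < n \<Longrightarrow> v i \<in> carrier_vec n" "\<And>i. i < n \<Longrightarrow> v i \<noteq> 0\<^sub>v n"
    "\<And>i. i < n \<Longrightarrow> X *\<^sub>v v i = \<theta> ! i \<cdot>\<^sub>v v i"
    by metis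
  define Q where "Q = mat n n (\<lambda>(i, j). v j $ i)"
  have Q: "Q \<in> carrier_mat n n"
    by (simp add: Q_def)
  have col: "col Q j = v j" if "j < n" for j
    using v(1)[OF that] that by (auto simp: Q_def)
  have XQ: "X * Q = Q * ?D"
  proof (rule eq_matI)
    fix i j assume "i < dim_row (Q * ?D)" "j < dim_col (Q * ?D)"
    then have ij: "i < n" "j < n"
      using Q by (auto simp: mat_diag_def)
    then have "(X * Q) $$ (i, j) = (X *\<^sub>v v j) $ i"
      using X Q col by simp
    also have "\<dots> = (Q * ?D) $$ (i, j)"
      using v[OF ij(2)] ij unfolding mat_diag_mult_right[OF Q] by (simp add: Q_def)
    finally show "(X * Q) $$ (i, j) = (Q * ?D) $$ (i, j)" .
  qed (use X Q in \<open>auto simp: mat_diag_def\<close>)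
  have E: "primitive_idempotent (module_mat TYPE('k) n n) X \<theta> i * Q = Q * diag_unit n i"
    if "i < n" for i
    using primitive_idempotent_intertwine[OF X mat_diag_dim Q XQ, of \<theta> i]
    by (simp add: primitive_idempotent_mat_diag[OF len dist that])
  have "det Q \<noteq> 0"
  proof
    assume "det Q = 0"
    then obtain c where c: "c \<in> carrier_vec n" "c \<noteq> 0\<^sub>v n" "Q *\<^sub>v c = 0\<^sub>v n"
      using det_0_iff_vec_prod_zero_field[OF Q] by blast
    obtain i where i: "i < n" "c $ i \<noteq> 0"
      using c by (auto simp: vec_eq_iff)
    let ?E = "primitive_idempotent (module_mat TYPE('k) n n) X \<theta> i"
    note Ec = primitive_idempotent_mat_closed[OF X, of \<theta> i]
    have "(Q * diag_unit n i) *\<^sub>v c = ?E *\<^sub>v (Q *\<^sub>v c)"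
      using assoc_mult_mat_vec[OF Ec Q c(1)] E[OF i(1)] by simp
    also have "\<dots> = 0\<^sub>v n"
      using c Ec by auto
    finally have *: "(Q * diag_unit n i) *\<^sub>v c = 0\<^sub>v n" .
    have "v i $ k = 0" if k: "k < n" for k
    proof -
      have "((Q * diag_unit n i) *\<^sub>v c) $ k = (\<Sum>j<n. Q $$ (k, j) * (if j = i then 1 else 0) * c $ j)"
        using k c Q by (simp add: mat_diag_mult_right[OF Q] scalar_prod_def atLeast0LessThan)
      also have "\<dots> = (\<Sum>j<n. if j = i then Q $$ (k, j) * c $ j else 0)"
        by (intro sum.cong) auto
      also have "\<dots> = v i $ k * c $ i"
        using i k by (simp add: Q_def)
      finally show ?thesis
        using * i k by simp
    qed
    then have "v i = 0\<^sub>v n"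
      using v(1)[OF i(1)] by (intro eq_vecI) auto
    then show False
      using v(2)[OF i(1)] by simp
  qed
  then obtain R where "R \<in> carrier_mat n n" "Q * R = 1\<^sub>m n" "R * Q = 1\<^sub>m n"
    using obtain_inverse_mat[OF Q] by blast
  with that Q XQ E show thesis
    by blast
qed

section \<open>Change to an LB-UB basis\<close>

lemma mult_mat_index:
  assumes "A \<in> carrier_mat n n" "B \<in> carrier_mat n n" "i < n" "j < n"
  shows "(A * B) $$ (i, j) = (\<Sum>k<n. A $$ (i, k) * B $$ (k, j))"
  using assms by (auto simp: scalar_prod_def atLeast0LessThan)

lemma mult_mat_vec_index:
  assumes "A \<in> carrier_mat n n" "v \<in> carrier_vec n" "i < n"
  shows "(A *\<^sub>v v) $ i = (\<Sum>k<n. A $$ (i, k) * v $ k)"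
  using assms by (auto simp: scalar_prod_def atLeast0LessThan)

lemma sum_single:
  assumes "finite A" "i \<in> A" "\<And>j. j \<in> A \<Longrightarrow> j \<noteq> i \<Longrightarrow> f j = (0 :: 'b :: comm_monoid_add)"
  shows "sum f A = f i"
proof -
  have "sum f A = sum f {i}"
    using assms by (intro sum.mono_neutral_right) auto
  then show ?thesis by simp
qed

lemma mult_mat_cancel_left:
  fixes Q R :: "'k :: semiring_1 mat"
  assumes "Q \<in> carrier_mat n n" "R \<in> carrier_mat n n" "R * Q = 1\<^sub>m n" "X \<in> carrier_mat n n"
  shows "R * (Q * X) = X"
  using assms assoc_mult_mat[of R n n Q n X n] by simp

text \<open>Forward substitution: row k of \<open>S * U\<close> is a nonzero multiple of row k of
  \<open>U\<close> plus a combination of earlier rows, which already vanish in column j. The offset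
  \<open>s\<close> is the number of superdiagonals allowed to survive; the bidiagonal bound takes it
  to be 1.\<close>

lemma lower_triangular_solve:
  fixes S U :: "'k :: field mat"
  assumes S: "S \<in> carrier_mat n n" and U: "U \<in> carrier_mat n n"
    and low: "\<And>k l. k < l \<Longrightarrow> l < n \<Longrightarrow> S $$ (k, l) = 0"
    and diag: "\<And>k. k < n \<Longrightarrow> S $$ (k, k) \<noteq> 0"
    and SU: "\<And>k j. k + s < j \<Longrightarrow> j < n \<Longrightarrow> (S * U) $$ (k, j) = 0"
  shows "k + s < j \<Longrightarrow> j < n \<Longrightarrow> U $$ (k, j) = 0"
proof (induction k rule: less_induct)
  case (less k)
  have "0 = (\<Sum>l<n. S $$ (k, l) * U $$ (l, j))"
    using less.prems SU[OF less.prems] mult_mat_index[OF S U, of k j] by simp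
  also have "\<dots> = S $$ (k, k) * U $$ (k, j)"
  proof (rule sum_single)
    fix l assume "l \<in> {..<n}" "l \<noteq> k"
    then show "S $$ (k, l) * U $$ (l, j) = 0"
      using low[of k l] less by (cases "l < k") auto
  qed (use less.prems in auto)
  finally show ?case
    using diag[of k] less.prems by simp
qed

text \<open>Backward substitution, starting from the last row; hence the induction on
  \<open>n - k\<close>.\<close>

lemma upper_triangular_solve:
  fixes S U :: "'k :: field mat"
  assumes S: "S \<in> carrier_mat n n" and U: "U \<in> carrier_mat n n"
    and upp: "\<And>k l. l < k \<Longrightarrow> k < n \<Longrightarrow> S $$ (k, l) = 0"
    and diag: "\<And>k. k < n \<Longrightarrow> S $$ (k, k) \<noteq> 0"
    and SU: "\<And>k j. j < k \<Longrightarrow> k < n \<Longrightarrow> (S * U) $$ (k, j) = 0"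
  shows "j < k \<Longrightarrow> k < n \<Longrightarrow> U $$ (k, j) = 0"
proof (induction "n - k" arbitrary: k rule: less_induct)
  case less
  have "0 = (\<Sum>l<n. S $$ (k, l) * U $$ (l, j))"
    using less.prems SU[OF less.prems] mult_mat_index[OF S U, of k j] by simp
  also have "\<dots> = S $$ (k, k) * U $$ (k, j)"
  proof (rule sum_single)
    fix l assume "l \<in> {..<n}" "l \<noteq> k"
    then show "S $$ (k, l) * U $$ (l, j) = 0"
      using upp[of l k] less.hyps[of l] less.prems by (cases "l < k") auto
  qed (use less.prems in auto)
  finally show ?case
    using diag[of k] less.prems by simp
qed

lemma prod_list_diag_mat:
  "A \<in> carrier_mat n n \<Longrightarrow> prod_list (diag_mat A) = (\<Prod>i<n. A $$ (i, i))"
  by (simp add: diag_mat_def atLeast0LessThan flip: prod.distinct_set_conv_list)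

text \<open>In the basis formed by the columns of \<open>Q\<close>, the product
  \<open>E * Y * F\<close> keeps only the entry (i, j) of the matrix of \<open>Y\<close>. This
  translates conditions on idempotents into conditions on matrix entries.\<close>

lemma idempotent_block_eq_0_iff:
  fixes Q R Y :: "'k :: field mat"
  assumes c: "Q \<in> carrier_mat n n" "R \<in> carrier_mat n n" "Y \<in> carrier_mat n n"
    "E \<in> carrier_mat n n" "F \<in> carrier_mat n n"
    and inv: "Q * R = 1\<^sub>m n" "R * Q = 1\<^sub>m n"
    and E: "E * Q = Q * diag_unit n i" and F: "F * Q = Q * diag_unit n j"
    and ij: "i < n" "j < n"
  shows "E * Y * F = 0\<^sub>m n n \<longleftrightarrow> (R * Y * Q) $$ (i, j) = 0"
proof -
  note assoc = assoc_mult_mat[of _ n n _ n _ n]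
  let ?Z = "R * Y * Q"
  have Z: "?Z \<in> carrier_mat n n"
    using c by auto
  have RE: "R * E = diag_unit n i * R"
  proof -
    have "R * E = R * (E * (Q * R))"
      using c inv by simp
    also have "\<dots> = R * (E * Q * R)"
      using c by (simp add: assoc)
    also have "\<dots> = R * (Q * (diag_unit n i * R))"
      unfolding E using c by (simp add: assoc mult_carrier_mat[of _ n n])
    finally show ?thesis
      using c inv by (simp add: mult_mat_cancel_left mult_carrier_mat[of _ n n])
  qed
  have "R * (E * Y * F) * Q = (R * E) * (Y * (F * Q))"
    using c by (simp add: assoc mult_carrier_mat[of _ n n])
  also have "\<dots> = diag_unit n i * ?Z * diag_unit n j"
    unfolding RE F using c by (simp add: assoc mult_carrier_mat[of _ n n])
  also have "\<dots> = mat n n (\<lambda>(k, l). if k = i \<and> l = j then ?Z $$ (k, l) else 0)"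
    using Z by (auto simp: mat_diag_mult_left[of _ n n] mat_diag_mult_right[of _ n n])
  finally have eq: "R * (E * Y * F) * Q = mat n n (\<lambda>(k, l). if k = i \<and> l = j then ?Z $$ (k, l) else 0)" .
  show ?thesis
  proof
    assume "E * Y * F = 0\<^sub>m n n"
    then have "mat n n (\<lambda>(k, l). if k = i \<and> l = j then ?Z $$ (k, l) else 0) = 0\<^sub>m n n"
      using eq c by simp
    from arg_cong[OF this, of "\<lambda>M. M $$ (i, j)"] show "?Z $$ (i, j) = 0"
      using ij by simp
  next
    assume "?Z $$ (i, j) = 0"
    then have 0: "R * (E * Y * F) * Q = 0\<^sub>m n n"
      unfolding eq by auto
    let ?G = "E * Y * F"
    have G: "?G \<in> carrier_mat n n"
      using c by auto
    \<comment> \<open>The change of basis is undone.\<close>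
    have "?G = Q * (R * ?G * Q) * R"
      using c G inv
      by (simp add: assoc mult_carrier_mat[of _ n n] mult_mat_cancel_left[of R n Q])
    then show "?G = 0\<^sub>m n n"
      unfolding 0 using c by simp
  qed
qed

text \<open>The action of \<open>A\<close> on an LB-UB basis: vector j goes to
  \<open>\<theta> ! j\<close> times itself plus the next vector.\<close>

definition LB_mat :: "nat \<Rightarrow> 'k :: field list \<Rightarrow> 'k mat" where
  "LB_mat n \<theta> = mat n n (\<lambda>(i, j). if i = j then \<theta> ! i else if i = j + 1 then 1 else 0)"

lemma LB_mat_carrier [simp]: "LB_mat n \<theta> \<in> carrier_mat n n"
  by (simp add: LB_mat_def)

text \<open>Below, \<open>X = Rs P\<close> and \<open>S = R P\<close> are the matrices of the \<open>LB\<close>-\<open>UB\<close> basis in eigenbases of \<open>As\<close> and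
  \<open>A\<close>; the two bidiagonality bounds on \<open>U\<close> come from \<open>X U = D\<^sub>s X\<close> and \<open>S U = C S\<close>.\<close>

lemma LB_UB_change_of_basis:
  fixes A As :: "'k :: field mat" and \<theta> \<theta>s :: "'k list" and n :: nat
  defines "E \<equiv> primitive_idempotent (module_mat TYPE('k) n n) A \<theta>"
    and "Es \<equiv> primitive_idempotent (module_mat TYPE('k) n n) As \<theta>s"
  assumes A: "A \<in> carrier_mat n n" and As: "As \<in> carrier_mat n n" and n: "0 < n"
    and \<theta>: "length \<theta> = n" "distinct \<theta>" "\<And>i. i < n \<Longrightarrow> eigenvalue A (\<theta> ! i)"
    and \<theta>s: "length \<theta>s = n" "distinct \<theta>s" "\<And>i. i < n \<Longrightarrow> eigenvalue As (\<theta>s ! i)"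
    and tri: "\<And>i j. i < n \<Longrightarrow> j < n \<Longrightarrow> \<bar>int i - int j\<bar> > 1 \<Longrightarrow> E i * As * E j = 0\<^sub>m n n"
    and tris: "\<And>i j. i < n \<Longrightarrow> j < n \<Longrightarrow> \<bar>int i - int j\<bar> > 1 \<Longrightarrow> Es i * A * Es j = 0\<^sub>m n n"
    and irr: "\<And>i j. i < n \<Longrightarrow> j < n \<Longrightarrow> \<bar>int i - int j\<bar> = 1 \<Longrightarrow> Es i * A * Es j \<noteq> 0\<^sub>m n n"
  obtains P P' where "P \<in> carrier_mat n n" "P' \<in> carrier_mat n n" "P * P' = 1\<^sub>m n" "P' * P = 1\<^sub>m n"
    "P' * A * P = LB_mat n \<theta>" "upper_bidiagonal (P' * As * P)" "(P' * As * P) $$ (0, 0) = \<theta>s ! 0"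
proof -
  note assoc = assoc_mult_mat[of _ n n _ n _ n] and cm = mult_carrier_mat[of _ n n _ n]
  let ?D = "mat_diag n ((!) \<theta>)" and ?Ds = "mat_diag n ((!) \<theta>s)"
  obtain Q R where Q: "Q \<in> carrier_mat n n" and R: "R \<in> carrier_mat n n"
    and QR: "Q * R = 1\<^sub>m n" and RQ: "R * Q = 1\<^sub>m n"
    and AQ: "A * Q = Q * ?D" and EQ: "\<And>i. i < n \<Longrightarrow> E i * Q = Q * diag_unit n i"
    using diagonalize[OF A \<theta>] unfolding E_def by metis
  obtain Qs Rs where Qs: "Qs \<in> carrier_mat n n" and Rs: "Rs \<in> carrier_mat n n"
    and QRs: "Qs * Rs = 1\<^sub>m n" and RQs: "Rs * Qs = 1\<^sub>m n"
    and AQs: "As * Qs = Qs * ?Ds" and EQs: "\<And>i. i < n \<Longrightarrow> Es i * Qs = Qs * diag_unit n i"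
    using diagonalize[OF As \<theta>s] unfolding Es_def by metis
  have Ec: "E i \<in> carrier_mat n n" and Esc: "Es i \<in> carrier_mat n n" for i
    unfolding E_def Es_def using primitive_idempotent_mat_closed A As by blast+
  \<comment> \<open>\<open>B\<close> is \<open>A\<close> in an eigenbasis of \<open>As\<close>, and
    \<open>C\<close> is \<open>As\<close> in an eigenbasis of \<open>A\<close>. The conditions on
    the idempotents make both tridiagonal.\<close>
  define B where "B = Rs * A * Qs"
  define C where "C = R * As * Q"
  have B: "B \<in> carrier_mat n n" and C: "C \<in> carrier_mat n n"
    using A As Q R Qs Rs by (auto simp: B_def C_def cm)
  have B0: "B $$ (i, j) = 0" if "i < n" "j < n" "\<bar>int i - int j\<bar> > 1" for i j
    using idempotent_block_eq_0_iff[OF Qs Rs A Esc Esc QRs RQs EQs EQs, of i j] tris[of i j] that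
    by (simp add: B_def)
  \<comment> \<open>The nonzero subdiagonal of \<open>B\<close> keeps the newest coordinate of each
    \<open>u i\<close> from vanishing.\<close>
  have B1: "B $$ (Suc i, i) \<noteq> 0" if "Suc i < n" for i
    using idempotent_block_eq_0_iff[OF Qs Rs A Esc Esc QRs RQs EQs EQs, of "Suc i" i]
      irr[of "Suc i" i] that
    by (simp add: B_def)
  have C0: "C $$ (i, j) = 0" if "i < n" "j < n" "\<bar>int i - int j\<bar> > 1" for i j
    using idempotent_block_eq_0_iff[OF Q R As Ec Ec QR RQ EQ EQ, of i j] tri[of i j] that
    by (simp add: C_def)
  have RA: "R * A = ?D * R"
  proof -
    have "R * A = R * (A * Q * R)"
      using A Q R QR by (simp add: assoc)
    also have "\<dots> = ?D * R"
      unfolding AQ using Q R RQ by (simp add: assoc cm mult_mat_cancel_left)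
    finally show ?thesis .
  qed
  have RAs: "Rs * As = ?Ds * Rs"
  proof -
    have "Rs * As = Rs * (As * Qs * Rs)"
      using As Qs Rs QRs by (simp add: assoc)
    also have "\<dots> = ?Ds * Rs"
      unfolding AQs using Qs Rs RQs by (simp add: assoc cm mult_mat_cancel_left)
    finally show ?thesis .
  qed
  have RsA: "Rs * A = B * Rs"
    using A Qs Rs QRs by (simp add: B_def assoc cm)

  \<comment> \<open>The LB-UB vectors and their coordinates in both eigenbases\<close>
  define u where "u = rec_nat (col Qs 0) (\<lambda>i v. A *\<^sub>v v - \<theta> ! i \<cdot>\<^sub>v v)"
  \<comment> \<open>Column 0 of \<open>Qs\<close> is an eigenvector of \<open>As\<close> for
    \<open>\<theta>s ! 0\<close>, so it spans the image of \<open>Es 0\<close>.\<close>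
  have u0: "u 0 = col Qs 0" and uS: "u (Suc i) = A *\<^sub>v u i - \<theta> ! i \<cdot>\<^sub>v u i" for i
    by (simp_all add: u_def)
  have u: "u i \<in> carrier_vec n" for i
    by (induction i) (use A Qs n in \<open>auto simp: u0 uS\<close>)
  \<comment> \<open>One step of the recursion in coordinates \<open>M\<close> in which
    \<open>A\<close> acts as \<open>N\<close>; applied to \<open>R\<close> with the diagonal matrix
    and to \<open>Rs\<close> with \<open>B\<close>.\<close>
  have step: "(M *\<^sub>v u (Suc i)) $ k = (N *\<^sub>v (M *\<^sub>v u i)) $ k - \<theta> ! i * (M *\<^sub>v u i) $ k"
    if "M \<in> carrier_mat n n" "N \<in> carrier_mat n n" "M * A = N * M" "k < n" for M N i k
  proof -
    have "M *\<^sub>v u (Suc i) = M *\<^sub>v (A *\<^sub>v u i) - M *\<^sub>v (\<theta> ! i \<cdot>\<^sub>v u i)"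
      unfolding uS using that A u[of i] by (intro mult_minus_distrib_mat_vec) auto
    also have "M *\<^sub>v (A *\<^sub>v u i) = N *\<^sub>v (M *\<^sub>v u i)"
      using that A u[of i] by (metis assoc_mult_mat_vec)
    also have "M *\<^sub>v (\<theta> ! i \<cdot>\<^sub>v u i) = \<theta> ! i \<cdot>\<^sub>v (M *\<^sub>v u i)"
      using that u[of i] by (intro mult_mat_vec) auto
    finally show ?thesis
      using that u[of i] by simp
  qed
  \<comment> \<open>In the eigenbasis of \<open>A\<close>, the factor with
    \<open>\<theta> ! k\<close> kills coordinate k, and the later factors are diagonal and keep it
    zero.\<close>
  have y: "(R *\<^sub>v u i) $ k = 0" if "k < i" "k < n" for i k
    using that
  proof (induction i)
    case (Suc i)
    have "(?D *\<^sub>v (R *\<^sub>v u i)) $ k = \<theta> ! k * (R *\<^sub>v u i) $ k"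
      using Suc.prems R u[of i]
      by (subst mult_mat_vec_index[of _ n], auto simp: mat_diag_def,
          subst sum_single[of _ k], auto)
    then show ?case
      using step[OF R mat_diag_dim RA Suc.prems(2), of i] Suc by (cases "k = i") auto
  qed simp
  \<comment> \<open>After n factors every coordinate has been killed. This settles the last column
    of \<open>A * P\<close>, where \<open>LB_mat\<close> has no subdiagonal entry.\<close>
  have un: "u n = 0\<^sub>v n"
  proof -
    have "R *\<^sub>v u n = 0\<^sub>v n"
      using y R by (intro eq_vecI) auto
    moreover have "u n = Q *\<^sub>v (R *\<^sub>v u n)"
      using Q R QR u[of n] by (simp flip: assoc_mult_mat_vec)
    ultimately show ?thesis
      using Q by auto
  qed
  \<comment> \<open>In the eigenbasis of \<open>As\<close>, tridiagonality lets the support grow by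
    one position per step. The new last coordinate is the subdiagonal entry of \<open>B\<close>
    times the previous last one, hence nonzero.\<close>
  have x: "(\<forall>k<n. i < k \<longrightarrow> (Rs *\<^sub>v u i) $ k = 0) \<and> (Rs *\<^sub>v u i) $ i \<noteq> 0" if "i < n" for i
    using that
  proof (induction i)
    case 0
    have "(Rs *\<^sub>v u 0) $ k = (Rs * Qs) $$ (k, 0)" if "k < n" for k
      using Rs Qs n that by (simp add: u0)
    then show ?case
      using n RQs by simp
  next
    case (Suc i)
    let ?x = "Rs *\<^sub>v u i"
    have xc: "?x \<in> carrier_vec n"
      using Rs u[of i] by auto
    have IH: "?x $ k = 0" if "i < k" "k < n" for k
      using Suc that by auto
    have "(B *\<^sub>v ?x) $ k = B $$ (k, i) * ?x $ i" if "i < k" "k < n" for k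
      unfolding mult_mat_vec_index[OF B xc that(2)]
    proof (rule sum_single)
      fix l assume "l \<in> {..<n}" "l \<noteq> i"
      then show "B $$ (k, l) * ?x $ l = 0"
        using that IH[of l] B0[of k l] by (cases "l < i") auto
    qed (use Suc.prems in auto)
    then have "(Rs *\<^sub>v u (Suc i)) $ k = B $$ (k, i) * ?x $ i" if "i < k" "k < n" for k
      using step[OF Rs B RsA that(2), of i] IH that by simp
    then show ?case
      using Suc B0[of _ i] B1[of i] by auto
  qed

  define P where "P = mat n n (\<lambda>(k, j). u j $ k)"
  have P: "P \<in> carrier_mat n n"
    by (simp add: P_def)
  have colP: "col P j = u j" if "j < n" for j
    using u[of j] that by (auto simp: P_def)
  have MP: "(M * P) $$ (k, j) = (M *\<^sub>v u j) $ k" if "M \<in> carrier_mat n n" "k < n" "j < n" for M k j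
    using that P colP by auto
  have AP: "A * P = P * LB_mat n \<theta>"
  proof (rule eq_matI)
    fix k j assume "k < dim_row (P * LB_mat n \<theta>)" "j < dim_col (P * LB_mat n \<theta>)"
    then have kj: "k < n" "j < n"
      using P by (auto simp: LB_mat_def)
    have "(P * LB_mat n \<theta>) $$ (k, j) = (\<Sum>l<n. P $$ (k, l) * LB_mat n \<theta> $$ (l, j))"
      by (rule mult_mat_index[OF P LB_mat_carrier kj])
    also have "\<dots> = (\<Sum>l<n. (if l = j then \<theta> ! j * u j $ k else 0) +
        (if l = Suc j then u (Suc j) $ k else 0))"
      using kj by (intro sum.cong) (auto simp: P_def LB_mat_def)
    also have "\<dots> = \<theta> ! j * u j $ k + u (Suc j) $ k"
    proof (cases "Suc j = n")
      case True
      then show ?thesis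
        using un kj by (simp add: sum.distrib)
    qed (use kj in \<open>simp add: sum.distrib\<close>)
    also have "\<dots> = (A *\<^sub>v u j) $ k"
      using A u[of j] kj by (simp add: uS)
    finally show "(A * P) $$ (k, j) = (P * LB_mat n \<theta>) $$ (k, j)"
      using MP[OF A kj] by simp
  qed (use A P in \<open>auto simp: LB_mat_def\<close>)

  \<comment> \<open>Triangularity and invertibility of the transition matrices\<close>
  let ?X = "Rs * P" and ?S = "R * P"
  have X: "?X \<in> carrier_mat n n" and S: "?S \<in> carrier_mat n n"
    using Rs R P by auto
  have X0: "?X $$ (k, l) = 0" if "l < k" "k < n" for k l
    using MP[OF Rs, of k l] x[of l] that by auto
  have Xd: "?X $$ (k, k) \<noteq> 0" if "k < n" for k
    using MP[OF Rs, of k k] x[of k] that by auto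
  have S0: "?S $$ (k, l) = 0" if "k < l" "l < n" for k l
    using MP[OF R, of k l] y[of k l] that by auto
  \<comment> \<open>The nonzero diagonal of the upper triangular matrix is what makes the vectors
    \<open>u i\<close> a basis.\<close>
  have "det ?X \<noteq> 0"
    using det_upper_triangular[OF _ X] X0 Xd X Rs P
    by (auto simp: prod_list_diag_mat[OF X] upper_triangular_def)
  then have detP: "det P \<noteq> 0"
    using det_mult[OF Rs P] by auto
  \<comment> \<open>For \<open>R * P\<close> the argument runs in the other direction: it is
    invertible because \<open>R\<close> and \<open>P\<close> are, and being lower triangular it must
    then have a nonzero diagonal.\<close>
  have "det R \<noteq> 0"
    using det_mult[OF R Q] RQ by auto
  then have "det ?S \<noteq> 0"
    using det_mult[OF R P] detP by auto
  then have Sd: "?S $$ (k, k) \<noteq> 0" if "k < n" for k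
    using det_lower_triangular[OF S0 S] that by (auto simp: prod_list_diag_mat[OF S])
  obtain P' where P': "P' \<in> carrier_mat n n" and PP': "P * P' = 1\<^sub>m n" and P'P: "P' * P = 1\<^sub>m n"
    using obtain_inverse_mat[OF P detP] by blast

  \<comment> \<open>The matrix of \<open>As\<close> in the LB-UB basis\<close>
  let ?U = "P' * As * P"
  have U: "?U \<in> carrier_mat n n"
    using P P' As by auto
  have PU: "P * ?U = As * P"
    using P P' As PP' by (simp add: assoc cm mult_mat_cancel_left[of P' n P])
  have XU: "?X * ?U = ?Ds * ?X"
  proof -
    have "?X * ?U = Rs * (P * ?U)"
      using assoc_mult_mat[OF Rs P U] .
    also have "\<dots> = (Rs * As) * P"
      unfolding PU using Rs As P by (simp add: assoc)
    finally show ?thesis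
      unfolding RAs using Rs P by (simp add: assoc)
  qed
  have SU: "?S * ?U = C * ?S"
  proof -
    have "?S * ?U = R * (P * ?U)"
      using assoc_mult_mat[OF R P U] .
    also have "\<dots> = C * ?S"
      unfolding PU C_def using R As P Q QR
      by (simp add: assoc cm mult_mat_cancel_left[of R n Q])
    finally show ?thesis .
  qed
  have DX: "(?Ds * ?X) $$ (k, j) = \<theta>s ! k * ?X $$ (k, j)" if "k < n" "j < n" for k j
    unfolding mat_diag_mult_left[OF X] using that by simp
  \<comment> \<open>\<open>?Ds * ?X\<close> is upper triangular, and solving for \<open>?U\<close>
    preserves this.\<close>
  have U_upper: "?U $$ (k, j) = 0" if "j < k" "k < n" for k j
  proof (rule upper_triangular_solve[OF X U X0 Xd _ that])
    fix k j assume "j < k" "k < n"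
    then show "(?X * ?U) $$ (k, j) = 0"
      unfolding XU using DX[of k j] X0[of j k] by simp
  qed
  \<comment> \<open>A tridiagonal matrix times a lower triangular one has at most one superdiagonal,
    and solving for \<open>?U\<close> preserves this.\<close>
  have U_low: "?U $$ (k, j) = 0" if "k + 1 < j" "j < n" for k j
  proof (rule lower_triangular_solve[OF S U S0 Sd _ that])
    fix k j assume kj: "k + 1 < j" "j < n"
    have "C $$ (k, l) * ?S $$ (l, j) = 0" if "l < n" for l
      using that kj C0[of k l] S0[of l j] by (cases "l < j") auto
    then have "(\<Sum>l<n. C $$ (k, l) * ?S $$ (l, j)) = 0"
      by (intro sum.neutral) blast
    then show "(?S * ?U) $$ (k, j) = 0"
      unfolding SU using kj mult_mat_index[OF C S, of k j] by simp
  qed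
  have "upper_bidiagonal ?U"
    unfolding upper_bidiagonal_def lower_bidiagonal_def
  proof (intro allI impI)
    fix i j assume ij: "i < dim_row (?U\<^sup>T)" "j < dim_col (?U\<^sup>T)" and nz: "?U\<^sup>T $$ (i, j) \<noteq> 0"
    then have "i < n" "j < n"
      using U by auto
    moreover from this have "?U $$ (j, i) \<noteq> 0"
      using nz carrier_matD[OF U] by (metis index_transpose_mat(1))
    ultimately have "\<not> i < j" "\<not> j + 1 < i"
      using U_upper[of i j] U_low[of j i] by auto
    then show "i = j \<or> i = j + 1"
      by linarith
  qed
  moreover have "?U $$ (0, 0) = \<theta>s ! 0"
  proof -
    \<comment> \<open>Comparing the corner entries of \<open>?X * ?U = ?Ds * ?X\<close>, where only
      one summand survives because column 0 of \<open>?U\<close> is zero below the diagonal.\<close>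
    have "\<theta>s ! 0 * ?X $$ (0, 0) = (?X * ?U) $$ (0, 0)"
      unfolding XU using DX n by simp
    also have "\<dots> = (\<Sum>l<n. ?X $$ (0, l) * ?U $$ (l, 0))"
      by (rule mult_mat_index[OF X U n n])
    also have "\<dots> = ?X $$ (0, 0) * ?U $$ (0, 0)"
      using n U_upper by (intro sum_single) auto
    finally show ?thesis
      using Xd[OF n] by simp
  qed
  moreover have "P' * A * P = LB_mat n \<theta>"
    using P P' A AP P'P by (simp add: assoc mult_mat_cancel_left[of P n P'])
  ultimately show thesis
    using that P P' PP' P'P by blast
qed

section \<open>The shape of a canonical form\<close>

lemma mult_mat_cancel_right:
  fixes Q R :: "'k :: semiring_1 mat"
  assumes "Q \<in> carrier_mat n n" "R \<in> carrier_mat n n" "Q * R = 1\<^sub>m n"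
    "X \<in> carrier_mat n n" "Y \<in> carrier_mat n n" "X * Q = Y * Q"
  shows "X = Y"
proof -
  have "X = X * Q * R"
    using assms(1-4) by (simp add: assoc_mult_mat[of X n n Q n R n])
  also have "\<dots> = Y"
    unfolding assms(6) using assms(1-3,5) by (simp add: assoc_mult_mat[of Y n n Q n R n])
  finally show ?thesis .
qed

text \<open>In an eigenbasis the idempotent becomes \<open>diag_unit n i\<close>. Each equation is
  verified after multiplying by \<open>Q\<close> on the right, and then \<open>Q\<close> is
  cancelled.\<close>

lemma primitive_idempotent_mat:
  fixes X :: "'k :: field mat" and n i :: nat and \<theta> :: "'k list"
  defines "E \<equiv> primitive_idempotent (module_mat TYPE('k) n n) X \<theta> i"
  assumes X: "X \<in> carrier_mat n n" and \<theta>: "length \<theta> = n" "distinct \<theta>"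
    "\<And>i. i < n \<Longrightarrow> eigenvalue X (\<theta> ! i)" and i: "i < n"
  shows "E * E = E" "X * E = \<theta> ! i \<cdot>\<^sub>m E"
    "E * X = \<theta> ! i \<cdot>\<^sub>m E" "E \<noteq> 0\<^sub>m n n"
proof -
  note assoc = assoc_mult_mat[of _ n n _ n _ n] and cm = mult_carrier_mat[of _ n n _ n]
  let ?D = "mat_diag n ((!) \<theta>)"
  obtain Q R where Q: "Q \<in> carrier_mat n n" and R: "R \<in> carrier_mat n n"
    and QR: "Q * R = 1\<^sub>m n" and RQ: "R * Q = 1\<^sub>m n"
    and XQ: "X * Q = Q * ?D" and EQ: "E * Q = Q * diag_unit n i"
    using diagonalize[OF X \<theta>] i unfolding E_def by metis
  have E: "E \<in> carrier_mat n n"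
    unfolding E_def by (rule primitive_idempotent_mat_closed[OF X])
  have smult: "\<theta> ! i \<cdot>\<^sub>m E * Q = Q * (\<theta> ! i \<cdot>\<^sub>m diag_unit n i)"
    using E Q EQ mult_smult_distrib[OF Q mat_diag_dim, of "\<theta> ! i" "\<lambda>k. if k = i then 1 else 0"]
    by (simp add: mult_smult_assoc_mat[of _ n n _ n])
  have "E * E * Q = E * (Q * diag_unit n i)"
    using assoc_mult_mat[OF E E Q] unfolding EQ .
  also have "\<dots> = E * Q * diag_unit n i"
    using E Q by (simp add: assoc)
  also have "\<dots> = Q * (diag_unit n i * diag_unit n i)"
    unfolding EQ using Q by (simp add: assoc del: mat_diag_diag)
  also have "diag_unit n i * diag_unit n i = diag_unit n i"
    unfolding mat_diag_diag by (auto simp: mat_diag_def)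
  finally show "E * E = E"
    using mult_mat_cancel_right[OF Q R QR, of "E * E" E] E EQ by (simp add: cm)
  have "X * E * Q = X * (Q * diag_unit n i)"
    using assoc_mult_mat[OF X E Q] unfolding EQ .
  also have "\<dots> = X * Q * diag_unit n i"
    using X Q by (simp add: assoc)
  also have "\<dots> = Q * (?D * diag_unit n i)"
    unfolding XQ using Q by (simp add: assoc del: mat_diag_diag)
  also have "?D * diag_unit n i = \<theta> ! i \<cdot>\<^sub>m diag_unit n i"
    unfolding mat_diag_diag by (auto simp: mat_diag_def)
  finally show "X * E = \<theta> ! i \<cdot>\<^sub>m E"
    using mult_mat_cancel_right[OF Q R QR, of "X * E" "\<theta> ! i \<cdot>\<^sub>m E"] E X smult by (simp add: cm)
  have "E * X * Q = E * (Q * ?D)"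
    using assoc_mult_mat[OF E X Q] unfolding XQ .
  also have "\<dots> = E * Q * ?D"
    using E Q by (simp add: assoc)
  also have "\<dots> = Q * (diag_unit n i * ?D)"
    unfolding EQ using Q by (simp add: assoc del: mat_diag_diag)
  also have "diag_unit n i * ?D = \<theta> ! i \<cdot>\<^sub>m diag_unit n i"
    unfolding mat_diag_diag by (auto simp: mat_diag_def)
  finally show "E * X = \<theta> ! i \<cdot>\<^sub>m E"
    using mult_mat_cancel_right[OF Q R QR, of "E * X" "\<theta> ! i \<cdot>\<^sub>m E"] E X smult by (simp add: cm)
  show "E \<noteq> 0\<^sub>m n n"
  proof
    assume "E = 0\<^sub>m n n"
    then have "R * (Q * diag_unit n i) = 0\<^sub>m n n"
      unfolding EQ[symmetric] using Q R by simp
    then have "diag_unit n i = (0\<^sub>m n n :: 'k mat)"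
      using mult_mat_cancel_left[OF Q R RQ mat_diag_dim] by metis
    from arg_cong[OF this, of "\<lambda>M. M $$ (i, i)"] show False
      using i by (simp add: mat_diag_def)
  qed
qed

lemma eigenvalues_of_mat:
  fixes X :: "'k :: field mat"
  assumes "X \<in> carrier_mat (d + 1) (d + 1)" "eigenvalues_of d (Mat_alg d) X Es \<theta>"
  shows "length \<theta> = d + 1" "distinct \<theta>" "\<And>i. i < d + 1 \<Longrightarrow> eigenvalue X (\<theta> ! i)"
    "\<And>i. i < d + 1 \<Longrightarrow> Es ! i = primitive_idempotent (Mat_alg d) X \<theta> i"
proof -
  show "length \<theta> = d + 1" "distinct \<theta>"
    using assms(2) by (auto simp: eigenvalues_of_def)
  show "eigenvalue X (\<theta> ! i)" if "i < d + 1" for i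
    using that assms(2) nth_mem[of i \<theta>]
    by (intro alg_eigenvalue_mat[OF assms(1)]) (auto simp: eigenvalues_of_def)
  show "Es ! i = primitive_idempotent (Mat_alg d) X \<theta> i" if "i < d + 1" for i
    using that assms(2) by (simp add: eigenvalues_of_def del: upt_Suc)
qed

text \<open>\<open>\<theta> ! i\<close> is recovered from the idempotent: it is the scalar by which
  \<open>X\<close> multiplies the nonzero matrix \<open>Es ! i\<close>.\<close>

lemma eigenvalues_of_mat_unique:
  fixes X :: "'k :: field mat"
  assumes X: "X \<in> carrier_mat (d + 1) (d + 1)"
    and \<theta>: "eigenvalues_of d (Mat_alg d) X Es \<theta>" and \<theta>': "eigenvalues_of d (Mat_alg d) X Es \<theta>'"
  shows "\<theta> = \<theta>'"
proof (rule nth_equalityI)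
  note e = eigenvalues_of_mat[OF X \<theta>] and e' = eigenvalues_of_mat[OF X \<theta>']
  show "length \<theta> = length \<theta>'"
    using e e' by simp
  fix i assume "i < length \<theta>"
  then have i: "i < d + 1"
    using e by simp
  have c: "Es ! i \<in> carrier_mat (d + 1) (d + 1)"
    unfolding e(4)[OF i] by (rule primitive_idempotent_mat_closed[OF X])
  have eq: "\<theta> ! i \<cdot>\<^sub>m Es ! i = \<theta>' ! i \<cdot>\<^sub>m Es ! i"
    using primitive_idempotent_mat(2)[OF X e(1-3) i] primitive_idempotent_mat(2)[OF X e'(1-3) i]
    unfolding e(4)[OF i, symmetric] e'(4)[OF i, symmetric] by simp
  have "Es ! i \<noteq> 0\<^sub>m (d + 1) (d + 1)"
    using primitive_idempotent_mat(4)[OF X e(1-3) i] unfolding e(4)[OF i, symmetric] .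
  then obtain k l where kl: "k < d + 1" "l < d + 1" "(Es ! i) $$ (k, l) \<noteq> 0"
    using c by (metis carrier_matD eq_matI index_zero_mat)
  from arg_cong[OF eq, of "\<lambda>M. M $$ (k, l)"] show "\<theta> ! i = \<theta>' ! i"
    using c kl by simp
qed

lemma eigenvalues_of_unique:
  assumes "k_algebra \<A>" and ne: "alg_iso \<A> (Mat_alg d) \<noteq> {}" and X: "X \<in> carrier \<A>"
    and "eigenvalues_of d \<A> X Es \<theta>" "eigenvalues_of d \<A> X Es \<theta>'"
  shows "\<theta> = \<theta>'"
proof -
  obtain \<phi> where "\<phi> \<in> alg_iso \<A> (Mat_alg d)"
    using ne by blast
  then interpret alg_isomorphism \<A> "Mat_alg d" \<phi>
    using assms(1) by (intro alg_isomorphism.intro alg_isomorphism_axioms.intro k_algebra_mat)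
  have "\<phi> X \<in> carrier_mat (d + 1) (d + 1)"
    using closed[OF X] by (simp add: module_mat_simps)
  then show ?thesis
    using eigenvalues_of_mat_unique eigenvalues_of X assms by metis
qed

text \<open>The columns of \<open>E\<close> are eigenvectors or zero. The first nonzero coordinate
  of an eigenvector of a lower triangular matrix must sit where the diagonal equals the
  eigenvalue.\<close>

lemma lower_triangular_eigencolumn:
  fixes M E :: "'k :: field mat"
  assumes M: "M \<in> carrier_mat n n" and E: "E \<in> carrier_mat n n"
    and low: "\<forall>l<n. \<forall>k<l. M $$ (k, l) = 0" and ME: "M * E = t \<cdot>\<^sub>m E"
    and diag: "\<And>k. k < b \<Longrightarrow> k < n \<Longrightarrow> M $$ (k, k) \<noteq> t"
  shows "k < b \<Longrightarrow> k < n \<Longrightarrow> l < n \<Longrightarrow> E $$ (k, l) = 0"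
proof (induction k rule: less_induct)
  case (less k)
  have "t * E $$ (k, l) = (\<Sum>p<n. M $$ (k, p) * E $$ (p, l))"
    using mult_mat_index[OF M E, of k l] less.prems E by (simp add: ME)
  also have "\<dots> = M $$ (k, k) * E $$ (k, l)"
  proof (rule sum_single)
    fix p assume "p \<in> {..<n}" "p \<noteq> k"
    then show "M $$ (k, p) * E $$ (p, l) = 0"
      using low less by (cases "p < k") auto
  qed (use less.prems in auto)
  finally show ?case
    using diag[of k] less.prems by simp
qed

text \<open>Dually, the last nonzero coordinate of a left eigenvector must sit where the diagonal
  equals the eigenvalue.\<close>

lemma lower_triangular_eigenrow:
  fixes M E :: "'k :: field mat"
  assumes M: "M \<in> carrier_mat n n" and E: "E \<in> carrier_mat n n"
    and low: "\<forall>l<n. \<forall>k<l. M $$ (k, l) = 0" and EM: "E * M = t \<cdot>\<^sub>m E"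
    and diag: "\<And>k. b \<le> k \<Longrightarrow> k < n \<Longrightarrow> M $$ (k, k) \<noteq> t"
  shows "k < n \<Longrightarrow> b \<le> l \<Longrightarrow> l < n \<Longrightarrow> E $$ (k, l) = 0"
proof (induction "n - l" arbitrary: l rule: less_induct)
  case less
  have "t * E $$ (k, l) = (\<Sum>p<n. E $$ (k, p) * M $$ (p, l))"
    using mult_mat_index[OF E M, of k l] less.prems E by (simp add: EM)
  also have "\<dots> = E $$ (k, l) * M $$ (l, l)"
  proof (rule sum_single)
    fix p assume "p \<in> {..<n}" "p \<noteq> l"
    then show "E $$ (k, p) * M $$ (p, l) = 0"
      using low less.hyps[of p] less.prems by (cases "p < l") auto
  qed (use less.prems in auto)
  finally show ?case
    using diag[of l] less.prems by simp
qed

text \<open>If \<open>\<theta> ! i\<close> were missing from the diagonal, the eigenrow bound with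
  \<open>b = 0\<close> would make \<open>E i\<close> zero. So n distinct values occur in n
  positions, and counting gives both claims.\<close>

lemma lower_triangular_diag:
  fixes M :: "'k :: field mat"
  assumes M: "M \<in> carrier_mat n n" and low: "\<forall>l<n. \<forall>k<l. M $$ (k, l) = 0"
    and \<theta>: "length \<theta> = n" "distinct \<theta>"
    and E: "\<forall>i<n. E i \<in> carrier_mat n n \<and> E i \<noteq> 0\<^sub>m n n \<and> E i * M = \<theta> ! i \<cdot>\<^sub>m E i"
  shows "inj_on (\<lambda>k. M $$ (k, k)) {..<n}" "(\<lambda>k. M $$ (k, k)) ` {..<n} = set \<theta>"
proof -
  let ?f = "\<lambda>k. M $$ (k, k)"
  have sub: "set \<theta> \<subseteq> ?f ` {..<n}"
  proof
    fix t assume "t \<in> set \<theta>"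
    then obtain i where i: "i < n" "t = \<theta> ! i"
      using \<theta> by (auto simp: in_set_conv_nth)
    show "t \<in> ?f ` {..<n}"
    proof (rule ccontr)
      assume t: "t \<notin> ?f ` {..<n}"
      have "M $$ (k, k) \<noteq> \<theta> ! i" if "k < n" for k
      proof
        assume "M $$ (k, k) = \<theta> ! i"
        then show False
          using t i that imageI[of k "{..<n}" ?f] by simp
      qed
      then have "E i $$ (k, l) = 0" if "k < n" "l < n" for k l
        using E i that by (intro lower_triangular_eigenrow[OF M _ low, of _ "\<theta> ! i" 0]) auto
      then have "E i = 0\<^sub>m n n"
        using E i by (intro eq_matI) auto
      then show False
        using E i by simp
    qed
  qed
  have card: "card (set \<theta>) = n"
    using \<theta> by (simp add: distinct_card)
  have "card (?f ` {..<n}) \<le> n"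
    using card_image_le[of "{..<n}" ?f] by simp
  then show "?f ` {..<n} = set \<theta>"
    using card_seteq[OF _ sub] card by simp
  then show "inj_on ?f {..<n}"
    using card by (intro eq_card_imp_inj_on) auto
qed

text \<open>If \<open>\<theta>\<^sub>i\<close> first occurred at a diagonal position \<open>b > i\<close>, then \<open>E\<^sub>i\<^sub>-\<^sub>1\<close> would live on columns \<open>< i\<close>
  and \<open>E\<^sub>i\<close> on rows \<open>\<ge> b\<close>, so the upper bidiagonal \<open>U\<close> could not connect them.\<close>

lemma lower_bidiagonal_diag:
  fixes L U :: "'k :: field mat"
  assumes L: "L \<in> carrier_mat n n" and U: "U \<in> carrier_mat n n"
    and Lb: "lower_bidiagonal L" and Ub: "upper_bidiagonal U"
    and \<theta>: "length \<theta> = n" "distinct \<theta>" and L0: "L $$ (0, 0) = \<theta> ! 0"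
    and E: "\<And>i. i < n \<Longrightarrow> E i \<in> carrier_mat n n" "\<And>i. i < n \<Longrightarrow> E i \<noteq> 0\<^sub>m n n"
      "\<And>i. i < n \<Longrightarrow> L * E i = \<theta> ! i \<cdot>\<^sub>m E i" "\<And>i. i < n \<Longrightarrow> E i * L = \<theta> ! i \<cdot>\<^sub>m E i"
    and irr: "\<And>i. Suc i < n \<Longrightarrow> E i * U * E (Suc i) \<noteq> 0\<^sub>m n n"
  shows "i < n \<Longrightarrow> L $$ (i, i) = \<theta> ! i"
proof (induction i rule: less_induct)
  case (less i)
  have low: "\<forall>l<n. \<forall>k<l. L $$ (k, l) = 0"
  proof (intro allI impI, rule ccontr)
    fix k l assume "l < n" "k < l" "L $$ (k, l) \<noteq> 0"
    moreover from this have "k < n" by simp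
    ultimately have "k = l \<or> k = l + 1"
      using Lb L unfolding lower_bidiagonal_def by blast
    then show False
      using \<open>k < l\<close> by simp
  qed
  have "\<forall>i<n. E i \<in> carrier_mat n n \<and> E i \<noteq> 0\<^sub>m n n \<and> E i * L = \<theta> ! i \<cdot>\<^sub>m E i"
    using E by blast
  note diag = lower_triangular_diag[OF L low \<theta> this]
  show ?case
  proof (cases i)
    case 0
    then show ?thesis
      using L0 by simp
  next
    case (Suc m)
    have "\<theta> ! i \<in> (\<lambda>k. L $$ (k, k)) ` {..<n}"
      using diag(2) less.prems \<theta> by simp
    then obtain b where b: "b < n" "L $$ (b, b) = \<theta> ! i"
      by auto
    \<comment> \<open>Earlier diagonal positions carry earlier eigenvalues, by the induction
      hypothesis.\<close>
    have "\<not> b < i"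
      using less b \<theta> by (auto simp: nth_eq_iff_index_eq)
    moreover have "\<not> i < b"
    proof
      assume ib: "i < b"
      have m: "m < n" "L $$ (m, m) = \<theta> ! m"
        using less Suc by auto
      \<comment> \<open>\<open>\<theta> ! m\<close> occurs on the diagonal at position m and, by
        injectivity, nowhere after it.\<close>
      have Em: "E m $$ (k, p) = 0" if "k < n" "m < p" "p < n" for k p
      proof (rule lower_triangular_eigenrow[OF L E(1)[OF m(1)] low E(4)[OF m(1)]])
        fix k assume "Suc m \<le> k" "k < n"
        then show "L $$ (k, k) \<noteq> \<theta> ! m"
          using m inj_onD[OF diag(1), of k m] by auto
      qed (use that in auto)
      have Ei: "E i $$ (q, l) = 0" if "q < b" "l < n" for q l
      proof (rule lower_triangular_eigencolumn[OF L E(1)[OF less.prems] low E(3)[OF less.prems]])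
        fix k assume "k < b" "k < n"
        then show "L $$ (k, k) \<noteq> \<theta> ! i"
          using b inj_onD[OF diag(1), of k b] by auto
      qed (use that b in auto)
      \<comment> \<open>Row p of \<open>U\<close> reaches only columns up to p + 1, which is at most
        i and hence less than b; there the rows of \<open>E i\<close> are zero.\<close>
      have UE: "(U * E i) $$ (p, l) = 0" if "p \<le> m" "l < n" for p l
      proof -
        have "U $$ (p, q) * E i $$ (q, l) = 0" if q: "q < n" for q
        proof (cases "q < b")
          case False
          have "U\<^sup>T $$ (q, p) = 0"
          proof (rule ccontr)
            assume "U\<^sup>T $$ (q, p) \<noteq> 0"
            then have "q = p \<or> q = p + 1"
              using Ub U q m \<open>p \<le> m\<close> unfolding upper_bidiagonal_def lower_bidiagonal_def by auto
            then show False
              using False ib Suc \<open>p \<le> m\<close> by simp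
          qed
          then show ?thesis
            using U q m \<open>p \<le> m\<close> by simp
        qed (use Ei[of q l] \<open>l < n\<close> in auto)
        then have "(\<Sum>q<n. U $$ (p, q) * E i $$ (q, l)) = 0"
          by (intro sum.neutral) blast
        then show ?thesis
          using mult_mat_index[OF U E(1)[OF less.prems], of p l] that m by simp
      qed
      have UEc: "U * E i \<in> carrier_mat n n"
        using U E(1)[OF less.prems] by auto
      have "E m * (U * E i) = 0\<^sub>m n n"
      proof (rule eq_matI)
        fix k l assume "k < dim_row (0\<^sub>m n n :: 'k mat)" "l < dim_col (0\<^sub>m n n :: 'k mat)"
        then have kl: "k < n" "l < n"
          by auto
        have "E m $$ (k, p) * (U * E i) $$ (p, l) = 0" if "p < n" for p
          using Em[of k p] UE[of p l] kl that by (cases "p \<le> m") auto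
        then have "(\<Sum>p<n. E m $$ (k, p) * (U * E i) $$ (p, l)) = 0"
          by (intro sum.neutral) blast
        then show "(E m * (U * E i)) $$ (k, l) = 0\<^sub>m n n $$ (k, l)"
          using mult_mat_index[OF E(1)[OF m(1)] UEc kl] kl by simp
      qed (use E(1)[OF m(1)] E(1)[OF less.prems] in auto)
      then show False
        using irr[of m] assoc_mult_mat[OF E(1)[OF m(1)] U E(1)[OF less.prems]] less.prems Suc
        by simp
    qed
    ultimately show ?thesis
      using b by simp
  qed
qed

text \<open>Transposition makes \<open>U\<close> lower triangular with \<open>\<theta> ! 0\<close>
  only at position 0, so only row 0 of \<open>E 0\<close> can be nonzero. The two equations express
  that \<open>E 0\<close> and the first diagonal matrix unit have the same column space.\<close>

lemma upper_bidiagonal_first_idempotent: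
  fixes U :: "'k :: field mat"
  assumes U: "U \<in> carrier_mat n n" and Ub: "upper_bidiagonal U" and n: "0 < n"
    and \<theta>: "length \<theta> = n" "distinct \<theta>" and U0: "U $$ (0, 0) = \<theta> ! 0"
    and E: "\<And>i. i < n \<Longrightarrow> E i \<in> carrier_mat n n" "\<And>i. i < n \<Longrightarrow> E i \<noteq> 0\<^sub>m n n"
      "\<And>i. i < n \<Longrightarrow> U * E i = \<theta> ! i \<cdot>\<^sub>m E i"
    and idem: "E 0 * E 0 = E 0"
  shows "diag_unit n 0 * E 0 = E 0" "E 0 * diag_unit n 0 = diag_unit n 0"
proof -
  have UT: "U\<^sup>T \<in> carrier_mat n n"
    using U by simp
  have low: "\<forall>l<n. \<forall>k<l. U\<^sup>T $$ (k, l) = 0"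
  proof (intro allI impI, rule ccontr)
    fix k l assume "l < n" "k < l" "U\<^sup>T $$ (k, l) \<noteq> 0"
    moreover from this have "k < n" by simp
    ultimately have "k = l \<or> k = l + 1"
      using Ub UT unfolding upper_bidiagonal_def lower_bidiagonal_def by blast
    then show False
      using \<open>k < l\<close> by simp
  qed
  have ET: "(E i)\<^sup>T \<in> carrier_mat n n" "(E i)\<^sup>T \<noteq> 0\<^sub>m n n" "(E i)\<^sup>T * U\<^sup>T = \<theta> ! i \<cdot>\<^sub>m (E i)\<^sup>T"
    if "i < n" for i
  proof -
    show "(E i)\<^sup>T \<noteq> 0\<^sub>m n n"
      using E(1,2)[OF that] by (metis transpose_transpose zero_transpose_mat)
    have "(E i)\<^sup>T * U\<^sup>T = (U * E i)\<^sup>T"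
      using transpose_mult[OF U E(1)[OF that]] by simp
    also have "\<dots> = \<theta> ! i \<cdot>\<^sub>m (E i)\<^sup>T"
      unfolding E(3)[OF that] by (rule eq_matI) auto
    finally show "(E i)\<^sup>T * U\<^sup>T = \<theta> ! i \<cdot>\<^sub>m (E i)\<^sup>T" .
  qed (use E(1) that in auto)
  then have "\<forall>i<n. (E i)\<^sup>T \<in> carrier_mat n n \<and> (E i)\<^sup>T \<noteq> 0\<^sub>m n n \<and>
    (E i)\<^sup>T * U\<^sup>T = \<theta> ! i \<cdot>\<^sub>m (E i)\<^sup>T"
    by blast
  note inj = lower_triangular_diag(1)[OF UT low \<theta> this]
  have "(E 0)\<^sup>T $$ (l, k) = 0" if "0 < k" "k < n" "l < n" for k l
  proof (rule lower_triangular_eigenrow[OF UT ET(1)[OF n] low ET(3)[OF n]])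
    fix k assume "1 \<le> k" "k < n"
    then show "U\<^sup>T $$ (k, k) \<noteq> \<theta> ! 0"
      using inj_onD[OF inj, of k 0] U0 U n by auto
  qed (use that in auto)
  then have E0: "E 0 $$ (k, l) = 0" if "0 < k" "k < n" "l < n" for k l
    using that E(1)[OF n] by simp
  show eE: "diag_unit n 0 * E 0 = E 0"
    unfolding mat_diag_mult_left[OF E(1)[OF n]] using E0 E(1)[OF n] by (intro eq_matI) auto
  obtain k l where kl: "k < n" "l < n" "E 0 $$ (k, l) \<noteq> 0"
    using E(1,2)[OF n] by (metis carrier_matD eq_matI index_zero_mat)
  then have k: "k = 0"
    using E0[of k l] by auto
  \<comment> \<open>Idempotency fixes the corner entry: a nonzero entry of row 0 equals itself times
    the corner.\<close>
  have "E 0 $$ (0, l) = (\<Sum>p<n. E 0 $$ (0, p) * E 0 $$ (p, l))"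
    using mult_mat_index[OF E(1)[OF n] E(1)[OF n] n kl(2)] idem by simp
  also have "\<dots> = E 0 $$ (0, 0) * E 0 $$ (0, l)"
    using n E0 kl by (intro sum_single) auto
  finally have "E 0 $$ (0, 0) = 1"
    using kl k by simp
  then show "E 0 * diag_unit n 0 = diag_unit n 0"
    unfolding mat_diag_mult_right[OF E(1)[OF n]] using E0 n
    by (intro eq_matI) (auto simp: mat_diag_def)
qed

text \<open>Extracts what the module computation uses: \<open>A\<close> is determined by its
  eigenvalue sequence, and the first dual idempotent has the same column space as the first diagonal
  matrix unit.\<close>

lemma LB_UB_canonical_formD:
  fixes \<Psi> :: "('k :: field, 'k mat) leonard_data"
  assumes \<Psi>: "in_LB_UB_canonical_form d \<Psi>" and \<theta>: "eigenvalue_sequence d \<Psi> \<theta>"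
  shows "op_A \<Psi> = LB_mat (d + 1) \<theta>" "diag_unit (d + 1) 0 * (idems_Es \<Psi> ! 0) = idems_Es \<Psi> ! 0"
    "(idems_Es \<Psi> ! 0) * diag_unit (d + 1) 0 = diag_unit (d + 1) 0"
proof -
  let ?n = "d + 1" and ?A = "op_A \<Psi>" and ?U = "op_As \<Psi>"
  have amb: "ambient \<Psi> = Mat_alg d" and LS: "leonard_system d \<Psi>"
    and Lb: "lower_bidiagonal ?A" and Ub: "upper_bidiagonal ?U"
    and sub: "\<And>i. 1 \<le> i \<Longrightarrow> i \<le> d \<Longrightarrow> ?A $$ (i, i - 1) = 1"
    using \<Psi> by (auto simp: in_LB_UB_canonical_form_def)
  have A: "?A \<in> carrier_mat ?n ?n" and U: "?U \<in> carrier_mat ?n ?n"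
    using LS by (auto simp: leonard_system_def multiplicity_free_def amb module_mat_simps)
  have \<theta>: "eigenvalues_of d (Mat_alg d) ?A (idems_E \<Psi>) \<theta>"
    using \<theta> by (simp add: eigenvalue_sequence_def amb)
  \<comment> \<open>The eigenvalue sequence hidden in the definition of the canonical form is the
    given one, by uniqueness.\<close>
  obtain \<theta>s where \<theta>s: "eigenvalues_of d (Mat_alg d) ?U (idems_Es \<Psi>) \<theta>s"
    and A0: "?A $$ (0, 0) = \<theta> ! 0" and U0: "?U $$ (0, 0) = \<theta>s ! 0"
    using \<Psi> eigenvalues_of_mat_unique[OF A \<theta>]
    by (auto simp: in_LB_UB_canonical_form_def eigenvalue_sequence_def dual_eigenvalue_sequence_def amb)
  note e = eigenvalues_of_mat[OF A \<theta>] and es = eigenvalues_of_mat[OF U \<theta>s]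
  have irr: "idems_E \<Psi> ! i * ?U * idems_E \<Psi> ! Suc i \<noteq> 0\<^sub>m ?n ?n" if "Suc i < ?n" for i
    using LS that by (auto simp: leonard_system_def idempotent_sequence_def amb module_mat_simps)
  have diag: "?A $$ (i, i) = \<theta> ! i" if "i < ?n" for i
  proof (rule lower_bidiagonal_diag[where E = "(!) (idems_E \<Psi>)", OF A U Lb Ub e(1,2) A0 _ _ _ _ irr that])
    fix i assume i: "i < ?n"
    note p = primitive_idempotent_mat[OF A e(1-3) i]
    show "idems_E \<Psi> ! i \<in> carrier_mat ?n ?n" "idems_E \<Psi> ! i \<noteq> 0\<^sub>m ?n ?n"
      "?A * idems_E \<Psi> ! i = \<theta> ! i \<cdot>\<^sub>m idems_E \<Psi> ! i"
      "idems_E \<Psi> ! i * ?A = \<theta> ! i \<cdot>\<^sub>m idems_E \<Psi> ! i"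
      using p primitive_idempotent_mat_closed[OF A] unfolding e(4)[OF i] by auto
  qed
  show "?A = LB_mat ?n \<theta>"
  proof (rule eq_matI)
    fix i j assume "i < dim_row (LB_mat ?n \<theta>)" "j < dim_col (LB_mat ?n \<theta>)"
    then have ij: "i < ?n" "j < ?n"
      by (auto simp: LB_mat_def)
    have "?A $$ (i, j) = 0" if "i \<noteq> j" "i \<noteq> j + 1"
      using Lb A ij that by (auto simp: lower_bidiagonal_def)
    then show "?A $$ (i, j) = LB_mat ?n \<theta> $$ (i, j)"
      using diag[OF ij(1)] sub[of i] ij by (auto simp: LB_mat_def)
  qed (use A in \<open>auto simp: LB_mat_def\<close>)
  note ps = primitive_idempotent_mat[OF U es(1-3)]
  have 0: "idems_Es \<Psi> ! 0 = primitive_idempotent (Mat_alg d) ?U \<theta>s 0"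
    by (rule es(4)) simp
  show "diag_unit ?n 0 * (idems_Es \<Psi> ! 0) = idems_Es \<Psi> ! 0"
    "(idems_Es \<Psi> ! 0) * diag_unit ?n 0 = diag_unit ?n 0"
    unfolding 0
    using upper_bidiagonal_first_idempotent[OF U Ub _ es(1,2) U0
        primitive_idempotent_mat_closed[OF U] ps(4) ps(2) ps(1)]
    by simp_all
qed

section \<open>LB-UB bases of modules\<close>

lemma (in left_module) act_zero: "a \<in> carrier R \<Longrightarrow> a \<odot>\<^bsub>M\<^esub> \<zero>\<^bsub>M\<^esub> = \<zero>\<^bsub>M\<^esub>"
  using act_r_distr[of a "\<zero>\<^bsub>M\<^esub>" "\<zero>\<^bsub>M\<^esub>"] act_closed[of a "\<zero>\<^bsub>M\<^esub>"] by simp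

lemma (in left_module) zero_act: "v \<in> carrier M \<Longrightarrow> \<zero>\<^bsub>R\<^esub> \<odot>\<^bsub>M\<^esub> v = \<zero>\<^bsub>M\<^esub>"
  using act_l_distr[of "\<zero>\<^bsub>R\<^esub>" "\<zero>\<^bsub>R\<^esub>" v] act_closed[of "\<zero>\<^bsub>R\<^esub>" v] by simp

abbreviation mat_unit :: "nat \<Rightarrow> nat \<Rightarrow> nat \<Rightarrow> 'k :: field mat" where
  "mat_unit n i j \<equiv> mat n n (\<lambda>(k, l). if k = i \<and> l = j then 1 else 0)"

lemma mat_unit_mult:
  fixes M :: "'k :: field mat"
  assumes "M \<in> carrier_mat n n" "j < n"
  shows "mat_unit n i j * M = mat n n (\<lambda>(k, l). if k = i then M $$ (j, l) else 0)"
proof (rule eq_matI)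
  fix k l assume "k < dim_row (mat n n (\<lambda>(k, l). if k = i then M $$ (j, l) else 0))"
    "l < dim_col (mat n n (\<lambda>(k, l). if k = i then M $$ (j, l) else 0))"
  then have kl: "k < n" "l < n" by auto
  have "(mat_unit n i j * M) $$ (k, l) = (\<Sum>p<n. mat_unit n i j $$ (k, p) * M $$ (p, l))"
    using assms kl by (intro mult_mat_index) auto
  also have "\<dots> = mat_unit n i j $$ (k, j) * M $$ (j, l)"
    using assms kl by (intro sum_single) auto
  finally show "(mat_unit n i j * M) $$ (k, l) =
      mat n n (\<lambda>(k, l). if k = i then M $$ (j, l) else 0) $$ (k, l)"
    using assms kl by simp
qed (use assms in auto)

lemma mult_mat_unit:
  fixes M :: "'k :: field mat"
  assumes "M \<in> carrier_mat n n" "i < n"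
  shows "M * mat_unit n i j = mat n n (\<lambda>(k, l). if l = j then M $$ (k, i) else 0)"
proof (rule eq_matI)
  fix k l assume "k < dim_row (mat n n (\<lambda>(k, l). if l = j then M $$ (k, i) else 0))"
    "l < dim_col (mat n n (\<lambda>(k, l). if l = j then M $$ (k, i) else 0))"
  then have kl: "k < n" "l < n" by auto
  have "(M * mat_unit n i j) $$ (k, l) = (\<Sum>p<n. M $$ (k, p) * mat_unit n i j $$ (p, l))"
    using assms kl by (intro mult_mat_index) auto
  also have "\<dots> = M $$ (k, i) * mat_unit n i j $$ (i, l)"
    using assms kl by (intro sum_single) auto
  finally show "(M * mat_unit n i j) $$ (k, l) =
      mat n n (\<lambda>(k, l). if l = j then M $$ (k, i) else 0) $$ (k, l)"
    using assms kl by simp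
qed (use assms in auto)

text \<open>\<open>X\<close> and \<open>e\<close> stand for \<open>A\<close> and the first dual
  idempotent, and \<open>\<rho>\<close> for an isomorphism onto a canonical form. \<open>V\<close>
  is a general left module, so that both an irreducible module and the left regular module are
  instances.\<close>

locale LB_UB_module =
  alg_isomorphism \<A> "module_mat TYPE('k) n n" \<rho> + V: left_module \<A> V
  for \<A> :: "('k :: field, 'a) module" and n :: nat and \<rho> :: "'a \<Rightarrow> 'k mat"
    and V :: "('a, 'v) module" +
  fixes X e :: 'a and \<theta> :: "'k list"
  assumes n: "0 < n" and X: "X \<in> carrier \<A>" and \<rho>X: "\<rho> X = LB_mat n \<theta>"
    and e: "e \<in> carrier \<A>" and unit_e: "diag_unit n 0 * \<rho> e = \<rho> e"
    and e_unit: "\<rho> e * diag_unit n 0 = diag_unit n 0"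
begin

definition g :: "'k mat \<Rightarrow> 'a" where
  "g = inv_into (carrier \<A>) \<rho>"

sublocale G: alg_isomorphism "module_mat TYPE('k) n n" \<A> g
  unfolding g_def by (rule inverse_iso)

lemma \<rho>_closed [simp, intro]: "Z \<in> carrier \<A> \<Longrightarrow> \<rho> Z \<in> carrier_mat n n"
  using closed by (simp add: module_mat_simps)

lemma g_\<rho> [simp]: "Z \<in> carrier \<A> \<Longrightarrow> g (\<rho> Z) = Z"
  using bij by (simp add: g_def bij_betw_def)

lemma g_closed [simp, intro]: "M \<in> carrier_mat n n \<Longrightarrow> g M \<in> carrier \<A>"
  using G.closed by (simp add: module_mat_simps)

lemma g_mult: "M \<in> carrier_mat n n \<Longrightarrow> N \<in> carrier_mat n n \<Longrightarrow> g (M * N) = g M \<otimes>\<^bsub>\<A>\<^esub> g N"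
  using G.mult by (simp add: module_mat_simps)

lemma g_add: "M \<in> carrier_mat n n \<Longrightarrow> N \<in> carrier_mat n n \<Longrightarrow> g (M + N) = g M \<oplus>\<^bsub>\<A>\<^esub> g N"
  using G.add by (simp add: module_mat_simps)

lemma g_one: "g (1\<^sub>m n) = \<one>\<^bsub>\<A>\<^esub>"
  using G.one by (simp add: module_mat_simps)

lemma g_zero: "g (0\<^sub>m n n) = \<zero>\<^bsub>\<A>\<^esub>"
  using G.zero by (simp add: module_mat_simps)

lemma g_smult: "M \<in> carrier_mat n n \<Longrightarrow> g (c \<cdot>\<^sub>m M) = c \<odot>\<^bsub>\<A>\<^esub> g M"
  using G.smult by (simp add: module_mat_simps)

lemma g_mult_act:
  "M \<in> carrier_mat n n \<Longrightarrow> N \<in> carrier_mat n n \<Longrightarrow> v \<in> carrier V \<Longrightarrow>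
    g (M * N) \<odot>\<^bsub>V\<^esub> v = g M \<odot>\<^bsub>V\<^esub> (g N \<odot>\<^bsub>V\<^esub> v)"
  by (simp add: g_mult V.act_assoc)

lemma g_smult_act:
  assumes "M \<in> carrier_mat n n" "v \<in> carrier V"
  shows "g (c \<cdot>\<^sub>m M) \<odot>\<^bsub>V\<^esub> v = (c \<odot>\<^bsub>\<A>\<^esub> \<one>\<^bsub>\<A>\<^esub>) \<odot>\<^bsub>V\<^esub> (g M \<odot>\<^bsub>V\<^esub> v)"
proof -
  have "c \<cdot>\<^sub>m M = (c \<cdot>\<^sub>m 1\<^sub>m n) * M"
    using assms by (simp add: mult_smult_assoc_mat[of _ n n _ n])
  then show ?thesis
    using assms g_mult_act[of "c \<cdot>\<^sub>m 1\<^sub>m n" M v] by (simp add: g_smult g_one)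
qed

abbreviation basis_vec :: "'v \<Rightarrow> nat \<Rightarrow> 'v" where
  "basis_vec \<eta> i \<equiv> g (mat_unit n i 0) \<odot>\<^bsub>V\<^esub> \<eta>"

lemma basis_vec_closed: "\<eta> \<in> carrier V \<Longrightarrow> basis_vec \<eta> i \<in> carrier V"
  by (intro V.act_closed) auto

text \<open>A combination of the vectors \<open>basis_vec \<eta> i\<close> is the action on
  \<open>\<eta>\<close> of a single matrix carrying the coefficients in column 0. The bound
  \<open>m\<close> makes induction on the number of terms possible.\<close>

lemma first_column_act:
  assumes \<eta>: "\<eta> \<in> carrier V" and "m \<le> n"
  shows "(\<Oplus>\<^bsub>V\<^esub>i \<in> {..<m}. (c i \<odot>\<^bsub>\<A>\<^esub> \<one>\<^bsub>\<A>\<^esub>) \<odot>\<^bsub>V\<^esub> basis_vec \<eta> i) =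
    g (mat n n (\<lambda>(k, l). if l = 0 \<and> k < m then c k else 0)) \<odot>\<^bsub>V\<^esub> \<eta>"
  using assms(2)
proof (induction m)
  case 0
  have C: "mat n n (\<lambda>(k, l). if l = 0 \<and> k < 0 then c k else 0) = 0\<^sub>m n n"
    by auto
  show ?case
    unfolding C using \<eta> V.zero_act by (simp add: g_zero)
next
  case (Suc m)
  let ?C = "\<lambda>m. mat n n (\<lambda>(k, l). if l = 0 \<and> k < m then c k else 0)"
  have cl: "(c i \<odot>\<^bsub>\<A>\<^esub> \<one>\<^bsub>\<A>\<^esub>) \<odot>\<^bsub>V\<^esub> basis_vec \<eta> i \<in> carrier V" for i
    using \<eta> basis_vec_closed by (intro V.act_closed A.scalar_closed) auto
  have C: "?C (Suc m) = c m \<cdot>\<^sub>m mat_unit n m 0 + ?C m"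
    using Suc.prems by (intro eq_matI) (auto simp: less_Suc_eq)
  have "(\<Oplus>\<^bsub>V\<^esub>i \<in> {..<Suc m}. (c i \<odot>\<^bsub>\<A>\<^esub> \<one>\<^bsub>\<A>\<^esub>) \<odot>\<^bsub>V\<^esub> basis_vec \<eta> i) =
      (c m \<odot>\<^bsub>\<A>\<^esub> \<one>\<^bsub>\<A>\<^esub>) \<odot>\<^bsub>V\<^esub> basis_vec \<eta> m \<oplus>\<^bsub>V\<^esub> g (?C m) \<odot>\<^bsub>V\<^esub> \<eta>"
    unfolding lessThan_Suc using Suc cl by (subst V.finsum_insert) auto
  also have "\<dots> = g (?C (Suc m)) \<odot>\<^bsub>V\<^esub> \<eta>"
    unfolding C using \<eta> by (subst g_add) (auto simp: V.act_l_distr g_smult_act)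
  finally show ?case .
qed

lemma fixed_vec:
  assumes "\<eta> \<in> (\<lambda>v. e \<odot>\<^bsub>V\<^esub> v) ` carrier V"
  shows "\<eta> \<in> carrier V" "basis_vec \<eta> 0 = \<eta>"
proof -
  obtain v where v: "v \<in> carrier V" "\<eta> = e \<odot>\<^bsub>V\<^esub> v"
    using assms by blast
  show "\<eta> \<in> carrier V"
    using v e V.act_closed by simp
  have unit: "mat_unit n 0 0 = (diag_unit n 0 :: 'k mat)"
    by (auto simp: mat_diag_def)
  have "basis_vec \<eta> 0 = g (diag_unit n 0 * \<rho> e) \<odot>\<^bsub>V\<^esub> v"
    unfolding unit using v e by (simp add: g_mult_act)
  then show "basis_vec \<eta> 0 = \<eta>"
    using v e by (simp add: unit_e)
qed

text \<open>Column i of \<open>LB_mat n \<theta> - \<theta> ! i \<cdot>\<^sub>m 1\<^sub>m n\<close>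
  has a single 1, in row i + 1, so this factor sends one first-column matrix unit to the
  next.\<close>

lemma LB_UB_vector_eq:
  assumes \<eta>: "\<eta> \<in> (\<lambda>v. e \<odot>\<^bsub>V\<^esub> v) ` carrier V"
  shows "i < n \<Longrightarrow> LB_UB_vector \<A> V X \<theta> \<eta> i = basis_vec \<eta> i"
proof (induction i)
  case 0
  then show ?case
    using fixed_vec[OF \<eta>] by simp
next
  case (Suc i)
  let ?L = "LB_mat n \<theta> - \<theta> ! i \<cdot>\<^sub>m 1\<^sub>m n"
  have L: "?L \<in> carrier_mat n n"
    by (intro minus_carrier_mat) simp
  have "X \<ominus>\<^bsub>\<A>\<^esub> \<theta> ! i \<odot>\<^bsub>\<A>\<^esub> \<one>\<^bsub>\<A>\<^esub> = g (\<rho> X) \<ominus>\<^bsub>\<A>\<^esub> g (\<theta> ! i \<cdot>\<^sub>m 1\<^sub>m n)"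
    using X by (simp add: g_smult g_one)
  also have "\<dots> = g (\<rho> X \<ominus>\<^bsub>module_mat TYPE('k) n n\<^esub> \<theta> ! i \<cdot>\<^sub>m 1\<^sub>m n)"
    using X by (intro G.minus[symmetric]) (auto simp: module_mat_simps)
  also have "\<dots> = g ?L"
    using X by (subst a_minus_mat) (auto simp: \<rho>X)
  finally have "LB_UB_vector \<A> V X \<theta> \<eta> (Suc i) = g (?L * mat_unit n i 0) \<odot>\<^bsub>V\<^esub> \<eta>"
    using Suc L fixed_vec(1)[OF \<eta>] by (simp add: g_mult_act)
  also have "?L * mat_unit n i 0 = mat_unit n (Suc i) 0"
    using Suc.prems unfolding mult_mat_unit[OF L Suc_lessD[OF Suc.prems]]
    by (intro eq_matI) (auto simp: LB_mat_def)
  finally show ?case .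
qed

text \<open>Since \<open>\<rho> Z * mat_unit n j 0\<close> has column j of \<open>\<rho> Z\<close>
  as its column 0, that column gives the coordinates of the image of vector j. Coordinates are
  unique because the units of row 0 extract them as multiples of the nonzero
  \<open>\<eta>\<close>.\<close>

lemma represents_iff:
  assumes \<eta>: "\<eta> \<in> (\<lambda>v. e \<odot>\<^bsub>V\<^esub> v) ` carrier V" "\<eta> \<noteq> \<zero>\<^bsub>V\<^esub>" and Z: "Z \<in> carrier \<A>"
  shows "represents \<A> V (map (LB_UB_vector \<A> V X \<theta> \<eta>) [0..<n]) Y Z \<longleftrightarrow> Y = \<rho> Z"
proof -
  note \<eta>c = fixed_vec(1)[OF \<eta>(1)]
  let ?C = "\<lambda>M j. mat n n (\<lambda>(k, l). if l = 0 \<and> k < n then M $$ (k, j) else 0) :: 'k mat"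
  have comb: "(\<Oplus>\<^bsub>V\<^esub>i \<in> {..<n}. (M $$ (i, j) \<odot>\<^bsub>\<A>\<^esub> \<one>\<^bsub>\<A>\<^esub>) \<odot>\<^bsub>V\<^esub> (map (LB_UB_vector \<A> V X \<theta> \<eta>) [0..<n] ! i)) =
      g (?C M j) \<odot>\<^bsub>V\<^esub> \<eta>" for M j
  proof -
    have "(\<Oplus>\<^bsub>V\<^esub>i \<in> {..<n}. (M $$ (i, j) \<odot>\<^bsub>\<A>\<^esub> \<one>\<^bsub>\<A>\<^esub>) \<odot>\<^bsub>V\<^esub> (map (LB_UB_vector \<A> V X \<theta> \<eta>) [0..<n] ! i)) =
      (\<Oplus>\<^bsub>V\<^esub>i \<in> {..<n}. (M $$ (i, j) \<odot>\<^bsub>\<A>\<^esub> \<one>\<^bsub>\<A>\<^esub>) \<odot>\<^bsub>V\<^esub> basis_vec \<eta> i)"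
      by (intro V.finsum_cong' refl funcsetI V.act_closed A.scalar_closed basis_vec_closed \<eta>c)
        (auto simp: LB_UB_vector_eq[OF \<eta>(1)])
    then show ?thesis
      using first_column_act[OF \<eta>c le_refl, of "\<lambda>i. M $$ (i, j)"] by simp
  qed
  have act: "Z \<odot>\<^bsub>V\<^esub> LB_UB_vector \<A> V X \<theta> \<eta> j = g (?C (\<rho> Z) j) \<odot>\<^bsub>V\<^esub> \<eta>"
    if j: "j < n" for j
  proof -
    have "?C (\<rho> Z) j = \<rho> Z * mat_unit n j 0"
      unfolding mult_mat_unit[OF \<rho>_closed[OF Z] j] by auto
    then show ?thesis
      using j Z \<eta>c by (simp add: g_mult_act LB_UB_vector_eq[OF \<eta>(1)])
  qed
  have coord: "g (mat_unit n 0 k) \<odot>\<^bsub>V\<^esub> (g (?C M j) \<odot>\<^bsub>V\<^esub> \<eta>) = (M $$ (k, j) \<odot>\<^bsub>\<A>\<^esub> \<one>\<^bsub>\<A>\<^esub>) \<odot>\<^bsub>V\<^esub> \<eta>"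
    if "k < n" for k j and M :: "'k mat"
  proof -
    have "mat_unit n 0 k * ?C M j = M $$ (k, j) \<cdot>\<^sub>m mat_unit n 0 0"
      using that by (subst mat_unit_mult) auto
    then show ?thesis
      using \<eta>c fixed_vec(2)[OF \<eta>(1)] by (simp add: g_smult_act flip: g_mult_act)
  qed
  \<comment> \<open>Otherwise the scalar \<open>a - b\<close> would annihilate
    \<open>\<eta>\<close>, and multiplying by its inverse would give \<open>\<eta>\<close> =
    0.\<close>
  have inj: "a = b" if "(a \<odot>\<^bsub>\<A>\<^esub> \<one>\<^bsub>\<A>\<^esub>) \<odot>\<^bsub>V\<^esub> \<eta> = (b \<odot>\<^bsub>\<A>\<^esub> \<one>\<^bsub>\<A>\<^esub>) \<odot>\<^bsub>V\<^esub> \<eta>" for a b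
  proof (rule ccontr)
    assume ne: "a \<noteq> b"
    let ?s = "\<lambda>c. g (c \<cdot>\<^sub>m 1\<^sub>m n) \<odot>\<^bsub>V\<^esub> \<eta>"
    have s: "?s c \<in> carrier V" for c
      using \<eta>c by (intro V.act_closed) auto
    have "a \<cdot>\<^sub>m 1\<^sub>m n = (a - b) \<cdot>\<^sub>m 1\<^sub>m n + b \<cdot>\<^sub>m (1\<^sub>m n :: 'k mat)"
      by (intro eq_matI) auto
    then have "?s a = ?s (a - b) \<oplus>\<^bsub>V\<^esub> ?s b"
      using \<eta>c by (simp add: g_add V.act_l_distr)
    moreover have "?s a = ?s b"
      using that by (simp add: g_smult g_one)
    ultimately have "?s (a - b) = \<zero>\<^bsub>V\<^esub>"
      using s by (metis V.add.r_cancel_one)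
    then have "g (inverse (a - b) \<cdot>\<^sub>m 1\<^sub>m n) \<odot>\<^bsub>V\<^esub> ?s (a - b) = \<zero>\<^bsub>V\<^esub>"
      by (simp add: V.act_zero)
    moreover have "inverse (a - b) \<cdot>\<^sub>m 1\<^sub>m n * ((a - b) \<cdot>\<^sub>m 1\<^sub>m n) = (1\<^sub>m n :: 'k mat)"
      using ne by (simp add: mult_smult_assoc_mat[of _ n n _ n]) (auto intro!: eq_matI)
    ultimately show False
      using \<eta> \<eta>c by (simp add: g_one V.act_one flip: g_mult_act)
  qed
  show ?thesis
  proof
    assume "represents \<A> V (map (LB_UB_vector \<A> V X \<theta> \<eta>) [0..<n]) Y Z"
    then have Y: "Y \<in> carrier_mat n n"
      and eq: "\<And>j. j < n \<Longrightarrow> g (?C (\<rho> Z) j) \<odot>\<^bsub>V\<^esub> \<eta> = g (?C Y j) \<odot>\<^bsub>V\<^esub> \<eta>"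
      unfolding represents_def by (simp_all add: comb act)
    show "Y = \<rho> Z"
    proof (rule eq_matI)
      fix k j assume "k < dim_row (\<rho> Z)" "j < dim_col (\<rho> Z)"
      then have kj: "k < n" "j < n"
        using \<rho>_closed[OF Z] by auto
      show "Y $$ (k, j) = \<rho> Z $$ (k, j)"
        using coord[OF kj(1), of Y j] coord[OF kj(1), of "\<rho> Z" j] eq[OF kj(2)] by (intro inj) simp
    qed (use Y \<rho>_closed[OF Z] in auto)
  next
    assume "Y = \<rho> Z"
    then show "represents \<A> V (map (LB_UB_vector \<A> V X \<theta> \<eta>) [0..<n]) Y Z"
      using Z unfolding represents_def by (simp add: comb act \<rho>_closed)
  qed
qed

text \<open>The identity is the sum of the products \<open>mat_unit n k 0 * mat_unit n 0 k\<close>,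
  so some \<open>mat_unit n 0 k\<close> does not kill a given nonzero vector. The resulting vector
  is fixed by \<open>e\<close>.\<close>

lemma exists_fixed_vec:
  assumes "carrier V \<noteq> {\<zero>\<^bsub>V\<^esub>}"
  obtains \<eta> where "\<eta> \<in> (\<lambda>v. e \<odot>\<^bsub>V\<^esub> v) ` carrier V" "\<eta> \<noteq> \<zero>\<^bsub>V\<^esub>"
proof -
  obtain v where v: "v \<in> carrier V" "v \<noteq> \<zero>\<^bsub>V\<^esub>"
    using assms V.zero_closed by blast
  have "\<exists>k<n. g (mat_unit n 0 k) \<odot>\<^bsub>V\<^esub> v \<noteq> \<zero>\<^bsub>V\<^esub>"
  proof (rule ccontr)
    assume "\<not> ?thesis"
    then have 0: "g (mat_unit n 0 k) \<odot>\<^bsub>V\<^esub> v = \<zero>\<^bsub>V\<^esub>" if "k < n" for k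
      using that by blast
    \<comment> \<open>Partial sums of this decomposition of the identity.\<close>
    let ?D = "\<lambda>m. mat_diag n (\<lambda>k. if k < m then 1 else 0 :: 'k)"
    have "g (?D m) \<odot>\<^bsub>V\<^esub> v = \<zero>\<^bsub>V\<^esub>" if "m \<le> n" for m
      using that
    proof (induction m)
      case 0
      have "?D 0 = 0\<^sub>m n n"
        by (auto simp: mat_diag_def)
      then show ?case
        using v V.zero_act by (simp add: g_zero)
    next
      case (Suc m)
      have "?D (Suc m) = ?D m + mat_unit n m 0 * mat_unit n 0 m"
        using Suc.prems n by (subst mat_unit_mult) (auto simp: mat_diag_def intro!: eq_matI)
      then show ?case
        using Suc v 0[of m] by (simp add: g_add V.act_l_distr g_mult_act V.act_zero mult_carrier_mat[of _ n n _ n])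
    qed
    moreover have "?D n = 1\<^sub>m n"
      by (auto simp: mat_diag_def)
    ultimately show False
      using v by (metis g_one le_refl V.act_one)
  qed
  then obtain k where k: "k < n" "g (mat_unit n 0 k) \<odot>\<^bsub>V\<^esub> v \<noteq> \<zero>\<^bsub>V\<^esub>"
    by blast
  let ?\<eta> = "g (mat_unit n 0 k) \<odot>\<^bsub>V\<^esub> v"
  have \<eta>c: "?\<eta> \<in> carrier V"
    using v by (intro V.act_closed) auto
  have unit: "diag_unit n 0 * mat_unit n 0 k = (mat_unit n 0 k :: 'k mat)"
    by (subst mat_diag_mult_left[of _ n n]) (auto intro!: eq_matI)
  have "\<rho> e * mat_unit n 0 k = mat_unit n 0 k"
    using assoc_mult_mat[of "\<rho> e" n n "diag_unit n 0" n "mat_unit n 0 k" n] e unit e_unit by simp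
  then have "e \<odot>\<^bsub>V\<^esub> ?\<eta> = ?\<eta>"
    using g_mult_act[of "\<rho> e" "mat_unit n 0 k" v] e v by simp
  then have "?\<eta> \<in> (\<lambda>v. e \<odot>\<^bsub>V\<^esub> v) ` carrier V"
    using \<eta>c by (intro image_eqI[of _ _ ?\<eta>]) simp_all
  then show thesis
    using k(2) by (rule that)
qed

end

text \<open>The algebra acting on itself by multiplication. It supplies a module over the element
  type of the algebra, so uniqueness can be proved before any module is given.\<close>

definition left_regular :: "('k, 'a) module \<Rightarrow> ('a, 'a) module" where
  "left_regular \<A> = \<lparr>carrier = carrier \<A>, monoid.mult = monoid.mult \<A>, one = \<one>\<^bsub>\<A>\<^esub>,
     zero = \<zero>\<^bsub>\<A>\<^esub>, add = add \<A>, smult = monoid.mult \<A>\<rparr>"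

lemma left_regular_module:
  assumes "ring \<A>"
  shows "left_module \<A> (left_regular \<A>)"
proof -
  interpret ring \<A> by fact
  have "abelian_group (left_regular \<A>)"
    by (rule abelian_groupI)
      (auto simp: left_regular_def a_ac intro: add.inv_closed l_neg)
  then show ?thesis
    by (intro left_module.intro left_module_axioms.intro assms)
      (auto simp: left_regular_def l_distr r_distr m_assoc)
qed

section \<open>Existence and uniqueness of the canonical form\<close>

lemma LB_UB_module_canonical_form:
  assumes LS: "leonard_system d \<Phi>" and \<theta>: "eigenvalue_sequence d \<Phi> \<theta>"
    and \<sigma>: "\<sigma> \<in> alg_iso (ambient \<Phi>) (Mat_alg d)"
    and can: "in_LB_UB_canonical_form d (leonard_image (Mat_alg d) \<sigma> \<Phi>)"
    and V: "left_module (ambient \<Phi>) V"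
  shows "LB_UB_module (ambient \<Phi>) (d + 1) \<sigma> V (op_A \<Phi>) (idems_Es \<Phi> ! 0) \<theta>"
proof -
  interpret alg_isomorphism "ambient \<Phi>" "Mat_alg d" \<sigma>
    using LS \<sigma> by (intro alg_isomorphism.intro alg_isomorphism_axioms.intro k_algebra_mat)
      (auto simp: leonard_system_def)
  let ?\<Psi> = "leonard_image (Mat_alg d) \<sigma> \<Phi>"
  have A: "op_A \<Phi> \<in> carrier (ambient \<Phi>)" "op_As \<Phi> \<in> carrier (ambient \<Phi>)"
    using LS by (auto simp: leonard_system_def multiplicity_free_def)
  have "eigenvalue_sequence d ?\<Psi> \<theta>"
    using \<theta> eigenvalues_of A by (simp add: eigenvalue_sequence_def leonard_image_def)
  note * = LB_UB_canonical_formD[OF can this]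
  obtain \<theta>s where "eigenvalues_of d (ambient \<Phi>) (op_As \<Phi>) (idems_Es \<Phi>) \<theta>s"
    using LS by (auto simp: leonard_system_def idempotent_sequence_def)
  then have Es: "idems_Es \<Phi> = map (primitive_idempotent (ambient \<Phi>) (op_As \<Phi>) \<theta>s) [0..<d + 1]"
    by (simp add: eigenvalues_of_def)
  have "idems_Es \<Phi> ! 0 \<in> carrier (ambient \<Phi>)" "map \<sigma> (idems_Es \<Phi>) ! 0 = \<sigma> (idems_Es \<Phi> ! 0)"
    unfolding Es using A by (simp_all add: A.primitive_idempotent_closed del: upt_Suc)
  then show ?thesis
    using * A(1) V
    by (intro LB_UB_module.intro LB_UB_module_axioms.intro alg_isomorphism_axioms)
      (simp_all add: leonard_image_def)
qed

text \<open>Any isomorphism onto the matrix algebra is corrected by conjugation with the change to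
  an LB-UB basis.\<close>

lemma exists_LB_UB_canonical_form:
  fixes \<Phi> :: "('k :: field, 'a) leonard_data"
  assumes LS: "leonard_system d \<Phi>"
  obtains \<sigma> where "\<sigma> \<in> alg_iso (ambient \<Phi>) (Mat_alg d)"
    "in_LB_UB_canonical_form d (leonard_image (Mat_alg d) \<sigma> \<Phi>)"
proof -
  let ?n = "d + 1" and ?M = "Mat_alg d :: ('k, 'k mat) module"
  obtain \<phi> where \<phi>: "\<phi> \<in> alg_iso (ambient \<Phi>) ?M"
    using LS by (auto simp: leonard_system_def)
  define \<Psi> where "\<Psi> = leonard_image ?M \<phi> \<Phi>"
  have amb: "ambient \<Psi> = ?M"
    by (simp add: \<Psi>_def leonard_image_def)
  have LS\<Psi>: "leonard_system d \<Psi>"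
    unfolding \<Psi>_def by (rule leonard_system_image[OF LS k_algebra_mat \<phi>])
  let ?A = "op_A \<Psi>" and ?As = "op_As \<Psi>"
  have A: "?A \<in> carrier_mat ?n ?n" and As: "?As \<in> carrier_mat ?n ?n"
    using LS\<Psi> by (auto simp: leonard_system_def multiplicity_free_def amb module_mat_simps)
  obtain \<theta> \<theta>s where \<theta>: "eigenvalues_of d ?M ?A (idems_E \<Psi>) \<theta>"
    and \<theta>s: "eigenvalues_of d ?M ?As (idems_Es \<Psi>) \<theta>s"
    using LS\<Psi> by (auto simp: leonard_system_def idempotent_sequence_def amb)
  note e = eigenvalues_of_mat[OF A \<theta>] and es = eigenvalues_of_mat[OF As \<theta>s]
  let ?E = "primitive_idempotent ?M ?A \<theta>" and ?Es = "primitive_idempotent ?M ?As \<theta>s"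
  have tri: "\<bar>int i - int j\<bar> > 1 \<Longrightarrow> ?E i * ?As * ?E j = 0\<^sub>m ?n ?n"
    "\<bar>int i - int j\<bar> > 1 \<Longrightarrow> ?Es i * ?A * ?Es j = 0\<^sub>m ?n ?n"
    "\<bar>int i - int j\<bar> = 1 \<Longrightarrow> ?Es i * ?A * ?Es j \<noteq> 0\<^sub>m ?n ?n" if "i < ?n" "j < ?n" for i j
    using LS\<Psi> that unfolding e(4)[OF that(1), symmetric] e(4)[OF that(2), symmetric]
      es(4)[OF that(1), symmetric] es(4)[OF that(2), symmetric]
    by (auto simp: leonard_system_def idempotent_sequence_def amb module_mat_simps)
  obtain P P' where P: "P \<in> carrier_mat ?n ?n" and P': "P' \<in> carrier_mat ?n ?n"
    and PP': "P * P' = 1\<^sub>m ?n" and P'P: "P' * P = 1\<^sub>m ?n"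
    and LB: "P' * ?A * P = LB_mat ?n \<theta>" and UB: "upper_bidiagonal (P' * ?As * P)"
    and UB0: "(P' * ?As * P) $$ (0, 0) = \<theta>s ! 0"
  proof (rule LB_UB_change_of_basis[OF A As _ e(1,2) _ es(1,2)])
    show "0 < ?n"
      by simp
  qed (use e(3) es(3) tri in blast)+
  define \<kappa> where "\<kappa> = (\<lambda>Z. P' * Z * P)"
  note assoc = assoc_mult_mat[of _ ?n ?n _ ?n _ ?n] and cm = mult_carrier_mat[of _ ?n ?n _ ?n]
  have \<kappa>: "\<kappa> \<in> alg_iso ?M ?M"
    unfolding alg_iso_def
  proof (intro CollectI conjI allI ballI)
    fix c Z assume "Z \<in> carrier ?M"
    then show "\<kappa> (c \<odot>\<^bsub>?M\<^esub> Z) = c \<odot>\<^bsub>?M\<^esub> \<kappa> Z"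
      using P P' by (simp add: \<kappa>_def module_mat_simps cm mult_smult_distrib[of _ ?n ?n _ ?n]
          mult_smult_assoc_mat[of _ ?n ?n _ ?n])
  next
    show "\<kappa> \<in> ring_iso ?M ?M"
    proof (rule ring_iso_memI)
      fix Y Z assume YZ: "Y \<in> carrier ?M" "Z \<in> carrier ?M"
      then show "\<kappa> Y \<in> carrier ?M"
        using P P' by (simp add: \<kappa>_def module_mat_simps cm)
      show "\<kappa> (Y \<oplus>\<^bsub>?M\<^esub> Z) = \<kappa> Y \<oplus>\<^bsub>?M\<^esub> \<kappa> Z"
        using P P' YZ by (simp add: \<kappa>_def module_mat_simps cm mult_add_distrib_mat[of _ ?n ?n _ ?n]
            add_mult_distrib_mat[of _ ?n ?n _ _ ?n])
      show "\<kappa> (Y \<otimes>\<^bsub>?M\<^esub> Z) = \<kappa> Y \<otimes>\<^bsub>?M\<^esub> \<kappa> Z"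
        using P P' YZ PP'
        by (simp add: \<kappa>_def module_mat_simps assoc cm mult_mat_cancel_left[of P' ?n P])
    next
      show "\<kappa> \<one>\<^bsub>?M\<^esub> = \<one>\<^bsub>?M\<^esub>"
        using P P' P'P by (simp add: \<kappa>_def module_mat_simps)
      show "bij_betw \<kappa> (carrier ?M) (carrier ?M)"
        by (rule bij_betw_byWitness[where f' = "\<lambda>Z. P * Z * P'"])
          (use P P' PP' P'P in \<open>auto simp: \<kappa>_def module_mat_simps assoc cm
            mult_mat_cancel_left[of P' ?n P] mult_mat_cancel_left[of P ?n P']\<close>)
    qed
  qed
  interpret K: alg_isomorphism ?M ?M \<kappa>
    by (intro alg_isomorphism.intro alg_isomorphism_axioms.intro k_algebra_mat \<kappa>)
  let ?\<sigma> = "\<kappa> \<circ> \<phi>"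
  have \<sigma>: "?\<sigma> \<in> alg_iso (ambient \<Phi>) ?M"
    by (rule alg_iso_comp[OF \<phi> \<kappa>])
  have img: "leonard_image ?M ?\<sigma> \<Phi> = leonard_image ?M \<kappa> \<Psi>"
    by (simp add: leonard_image_def \<Psi>_def)
  have "eigenvalue_sequence d (leonard_image ?M \<kappa> \<Psi>) \<theta>"
    "dual_eigenvalue_sequence d (leonard_image ?M \<kappa> \<Psi>) \<theta>s"
    using K.eigenvalues_of[OF _ \<theta>] K.eigenvalues_of[OF _ \<theta>s] A As
    by (simp_all add: eigenvalue_sequence_def dual_eigenvalue_sequence_def leonard_image_def
        module_mat_simps)
  moreover have "leonard_system d (leonard_image ?M \<kappa> \<Psi>)"
    by (rule leonard_system_image[OF LS\<Psi> k_algebra_mat]) (unfold amb, rule \<kappa>)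
  moreover have "lower_bidiagonal (LB_mat ?n \<theta>)"
    by (auto simp: lower_bidiagonal_def LB_mat_def)
  ultimately have "in_LB_UB_canonical_form d (leonard_image ?M \<kappa> \<Psi>)"
    using LB UB UB0
    by (auto simp: in_LB_UB_canonical_form_def leonard_image_def \<kappa>_def LB_mat_def)
  then show thesis
    using that \<sigma> img by simp
qed

text \<open>All elements listed in a Leonard system lie in the carrier. This matters because the
  canonical map, being a definite description, is identified only on the carrier.\<close>

lemma leonard_image_cong:
  assumes LS: "leonard_system d \<Phi>"
    and eq: "\<And>Z. Z \<in> carrier (ambient \<Phi>) \<Longrightarrow> \<sigma> Z = \<tau> Z"
  shows "leonard_image \<B> \<sigma> \<Phi> = leonard_image \<B> \<tau> \<Phi>"
proof -
  interpret k_algebra "ambient \<Phi>"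
    using LS by (simp add: leonard_system_def)
  have A: "op_A \<Phi> \<in> carrier (ambient \<Phi>)" "op_As \<Phi> \<in> carrier (ambient \<Phi>)"
    using LS by (auto simp: leonard_system_def multiplicity_free_def)
  obtain \<theta> \<theta>s where "eigenvalues_of d (ambient \<Phi>) (op_A \<Phi>) (idems_E \<Phi>) \<theta>"
    "eigenvalues_of d (ambient \<Phi>) (op_As \<Phi>) (idems_Es \<Phi>) \<theta>s"
    using LS by (auto simp: leonard_system_def idempotent_sequence_def)
  then have "idems_E \<Phi> = map (primitive_idempotent (ambient \<Phi>) (op_A \<Phi>) \<theta>) [0..<d + 1]"
    "idems_Es \<Phi> = map (primitive_idempotent (ambient \<Phi>) (op_As \<Phi>) \<theta>s) [0..<d + 1]"
    by (simp_all add: eigenvalues_of_def)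
  then show ?thesis
    using A eq primitive_idempotent_closed by (simp add: leonard_image_def)
qed

theorem theorem14p6:
  fixes \<Phi> :: "('k :: field, 'a) leonard_data" and d :: nat
  assumes "leonard_system d \<Phi>"
  shows "(\<exists>!\<Psi>. LB_UB_canonical_form_for d \<Phi> \<Psi>) \<and>
    (\<forall>V :: ('a, 'v) module. irreducible_left_module (ambient \<Phi>) V \<longrightarrow>
       LB_UB_canonical_form_for d \<Phi>
         (leonard_image (Mat_alg d) (LB_UB_canonical_map d \<Phi> V) \<Phi>))"
proof -
  let ?\<A> = "ambient \<Phi>" and ?M = "Mat_alg d :: ('k, 'k mat) module"
  interpret k_algebra ?\<A>
    using assms by (simp add: leonard_system_def)
  have A: "op_A \<Phi> \<in> carrier ?\<A>"
    using assms by (auto simp: leonard_system_def multiplicity_free_def)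
  obtain \<theta> where \<theta>: "eigenvalue_sequence d \<Phi> \<theta>"
    using assms by (auto simp: leonard_system_def idempotent_sequence_def eigenvalue_sequence_def)
  obtain \<rho> where \<rho>: "\<rho> \<in> alg_iso ?\<A> ?M" and can: "in_LB_UB_canonical_form d (leonard_image ?M \<rho> \<Phi>)"
    by (rule exists_LB_UB_canonical_form[OF assms])
  let ?\<Psi> = "leonard_image ?M \<rho> \<Phi>"
  have form: "LB_UB_canonical_form_for d \<Phi> ?\<Psi>"
    using \<rho> can by (auto simp: LB_UB_canonical_form_for_def leonard_isomorphic_def leonard_image_def)
  note mod = LB_UB_module_canonical_form[OF assms \<theta>]
  have "\<Psi> = ?\<Psi>" if \<Psi>: "LB_UB_canonical_form_for d \<Phi> \<Psi>" for \<Psi>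
  proof -
    have amb: "ambient \<Psi> = ?M"
      using \<Psi> by (simp add: LB_UB_canonical_form_for_def in_LB_UB_canonical_form_def)
    obtain \<sigma> where \<sigma>: "\<sigma> \<in> alg_iso ?\<A> ?M" and \<Psi>_eq: "\<Psi> = leonard_image ?M \<sigma> \<Phi>"
      using \<Psi> by (auto simp: LB_UB_canonical_form_for_def leonard_isomorphic_def amb)
    have can': "in_LB_UB_canonical_form d (leonard_image ?M \<sigma> \<Phi>)"
      using \<Psi> by (simp add: LB_UB_canonical_form_for_def \<Psi>_eq)
    let ?V = "left_regular ?\<A>"
    note V = left_regular_module[OF is_ring]
    interpret R: LB_UB_module ?\<A> "d + 1" \<rho> ?V "op_A \<Phi>" "idems_Es \<Phi> ! 0" \<theta>
      by (rule mod[OF \<rho> can V])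
    interpret S: LB_UB_module ?\<A> "d + 1" \<sigma> ?V "op_A \<Phi>" "idems_Es \<Phi> ! 0" \<theta>
      by (rule mod[OF \<sigma> can' V])
    \<comment> \<open>The matrix size is at least 1, so the algebra is nonzero and its regular
      module contains a starting vector.\<close>
    have "(1\<^sub>m (d + 1) :: 'k mat) \<noteq> 0\<^sub>m (d + 1) (d + 1)"
    proof
      assume eq: "(1\<^sub>m (d + 1) :: 'k mat) = 0\<^sub>m (d + 1) (d + 1)"
      from arg_cong[OF eq, of "\<lambda>M. M $$ (0, 0)"] show False
        by simp
    qed
    then have "\<rho> \<one>\<^bsub>?\<A>\<^esub> \<noteq> \<rho> \<zero>\<^bsub>?\<A>\<^esub>"
      unfolding R.one R.zero module_mat_simps .
    then have "\<one>\<^bsub>?\<A>\<^esub> \<noteq> \<zero>\<^bsub>?\<A>\<^esub>"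
      by metis
    moreover have "\<one>\<^bsub>?\<A>\<^esub> \<in> carrier ?V"
      by (simp add: left_regular_def)
    ultimately have "carrier ?V \<noteq> {\<zero>\<^bsub>?V\<^esub>}"
      by (auto simp: left_regular_def)
    then obtain \<eta> where \<eta>: "\<eta> \<in> (\<lambda>v. (idems_Es \<Phi> ! 0) \<odot>\<^bsub>?V\<^esub> v) ` carrier ?V" "\<eta> \<noteq> \<zero>\<^bsub>?V\<^esub>"
      by (rule R.exists_fixed_vec)
    \<comment> \<open>Both are the matrix of \<open>Z\<close> with respect to the same LB-UB basis,
      whose definition involves neither isomorphism.\<close>
    have "\<sigma> Z = \<rho> Z" if "Z \<in> carrier ?\<A>" for Z
      using R.represents_iff[OF \<eta> that] S.represents_iff[OF \<eta> that] by blast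
    then show ?thesis
      unfolding \<Psi>_eq by (rule leonard_image_cong[OF assms])
  qed
  moreover have "LB_UB_canonical_form_for d \<Phi> (leonard_image ?M (LB_UB_canonical_map d \<Phi> V) \<Phi>)"
    if V: "irreducible_left_module ?\<A> V" for V :: "('a, 'v) module"
  proof -
    interpret R: LB_UB_module ?\<A> "d + 1" \<rho> V "op_A \<Phi>" "idems_Es \<Phi> ! 0" \<theta>
      using V by (intro mod[OF \<rho> can]) (simp add: irreducible_left_module_def)
    obtain \<eta> where \<eta>: "\<eta> \<in> (\<lambda>v. (idems_Es \<Phi> ! 0) \<odot>\<^bsub>V\<^esub> v) ` carrier V" "\<eta> \<noteq> \<zero>\<^bsub>V\<^esub>"
      using V by (auto simp: irreducible_left_module_def intro: R.exists_fixed_vec)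
    have unique: "\<theta>' = \<theta>" if "eigenvalue_sequence d \<Phi> \<theta>'" for \<theta>'
      using eigenvalues_of_unique[OF k_algebra_axioms _ A] that \<theta> \<rho>
      unfolding eigenvalue_sequence_def by blast
    have "LB_UB_canonical_map d \<Phi> V Z = \<rho> Z" if Z: "Z \<in> carrier ?\<A>" for Z
      unfolding LB_UB_canonical_map_def
    proof (rule the_equality)
      show "\<exists>vs. LB_UB_basis d \<Phi> V vs \<and> represents ?\<A> V vs (\<rho> Z) Z"
        using \<theta> \<eta> R.represents_iff[OF \<eta> Z] unfolding LB_UB_basis_def by blast
    next
      fix Y assume "\<exists>vs. LB_UB_basis d \<Phi> V vs \<and> represents ?\<A> V vs Y Z"
      then obtain \<theta>' \<eta>' where \<theta>': "eigenvalue_sequence d \<Phi> \<theta>'"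
        and \<eta>': "\<eta>' \<in> (\<lambda>v. (idems_Es \<Phi> ! 0) \<odot>\<^bsub>V\<^esub> v) ` carrier V" "\<eta>' \<noteq> \<zero>\<^bsub>V\<^esub>"
        and rep: "represents ?\<A> V (map (LB_UB_vector ?\<A> V (op_A \<Phi>) \<theta>' \<eta>') [0..<d + 1]) Y Z"
        unfolding LB_UB_basis_def by blast
      \<comment> \<open>The matrix is \<open>\<rho> Z\<close> for every starting vector, which makes
        the definite description well defined.\<close>
      show "Y = \<rho> Z"
        using R.represents_iff[OF \<eta>' Z] rep unique[OF \<theta>'] by blast
    qed
    then have "leonard_image ?M (LB_UB_canonical_map d \<Phi> V) \<Phi> = ?\<Psi>"
      by (rule leonard_image_cong[OF assms])
    then show ?thesis
      using form by simp
  qed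
  ultimately show ?thesis
    using form by blast
qed

end
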